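(* Let $n\in\mathbb N$ and let $\mathcal B_n\subset C(U_n^+)\subset L^\infty(U_n^+)$ be the norm-closed unital non-self-adjoint operator algebra generated by the coefficients $\{u_{rs}\}_{1\le r,s\le n}$ of the fundamental corepresentation of the free unitary quantum group $U_n^+$. Then $\mathcal B_n$ has the metric approximation property.
   Context: A Banach space $Y$ has the metric approximation property if there is a net $\{S_\alpha\}$ of finite rank contractions in $B(Y)$ with $\lim_\alpha\|S_\alpha y-y\|=0$ for all $y\in Y$. The free unitary quantum group is the compact matrix quantum group $U_n^+=(A_u(n),U)$, where $A_u(n)$ is the universal unital C$^*$-algebra generated by $\{u_{rs}:1\le r,s\le n\}$ subject to the relations making $U=[u_{rs}]$ and $\overline U=[u_{rs}^*]$ both unitary in $M_n(A_u(n))$, with coproduct $\Delta u_{rs}=\sum_{k=1}^nu_{rk}\otimes u_{ks}$. Its Haar state $h$ is the unique state with $(h\otimes\mathrm{id})\Delta(a)=(\mathrm{id}\otimes h)\Delta(a)=h(a)1$ for all $a$; it is a trace. $C(U_n^+)$ is the image of $A_u(n)$ in the GNS representation of $h$, and $L^\infty(U_n^+)$ is the von Neumann algebra it generates; the images of the generators are still denoted $u_{rs}$. $\mathcal B_n$ is the norm closure of the unital algebra generated by the $u_{rs}$ (without their adjoints). *)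

theory Defs
  imports "HOL-Analysis.Analysis"
begin

section \<open>Complex Banach and Hilbert spaces, C*-algebras\<close>

class complex_vector = real_vector +
  fixes scaleC :: "complex \<Rightarrow> 'a \<Rightarrow> 'a" (infixr "*\<^sub>C" 75)
  assumes scaleC_add_right: "c *\<^sub>C (x + y) = c *\<^sub>C x + c *\<^sub>C y"
    and scaleC_add_left: "(c + d) *\<^sub>C x = c *\<^sub>C x + d *\<^sub>C x"
    and scaleC_scaleC: "c *\<^sub>C d *\<^sub>C x = (c * d) *\<^sub>C x"
    and scaleC_of_real: "complex_of_real r *\<^sub>C x = r *\<^sub>R x"

global_interpretation complex_vector: vector_space "scaleC :: complex \<Rightarrow> 'a \<Rightarrow> 'a::complex_vector"
proof
  fix x :: 'a
  show "1 *\<^sub>C x = x"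
    using scaleC_of_real[of 1 x] by simp
qed (simp_all add: scaleC_add_right scaleC_add_left scaleC_scaleC)

lemma scaleC_scaleR: "c *\<^sub>C r *\<^sub>R x = r *\<^sub>R c *\<^sub>C (x::'a::complex_vector)"
  by (simp add: scaleC_scaleC mult.commute flip: scaleC_of_real)

class complex_normed_vector = complex_vector + real_normed_vector +
  assumes norm_scaleC: "norm (c *\<^sub>C x) = cmod c * norm x"

instantiation complex :: complex_normed_vector
begin

definition scaleC_complex :: "complex \<Rightarrow> complex \<Rightarrow> complex" where
  "scaleC_complex c x = c * x"

instance
  by standard (auto simp: scaleC_complex_def algebra_simps norm_mult scaleR_conv_of_real)

end

class chilbert_space = complex_normed_vector + banach +
  fixes cinner :: "'a \<Rightarrow> 'a \<Rightarrow> complex"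
  assumes cinner_commute: "cinner x y = cnj (cinner y x)"
    and cinner_add_right: "cinner x (y + z) = cinner x y + cinner x z"
    and cinner_scaleC_right: "cinner x (c *\<^sub>C y) = c * cinner x y"
    and cinner_self: "cinner x x = complex_of_real ((norm x)\<^sup>2)"

class cstar_algebra = complex_normed_vector + real_normed_algebra_1 + banach +
  fixes star :: "'a \<Rightarrow> 'a"
  assumes mult_scaleC_left: "(c *\<^sub>C x) * y = c *\<^sub>C (x * y)"
    and mult_scaleC_right: "x * (c *\<^sub>C y) = c *\<^sub>C (x * y)"
    and star_star: "star (star x) = x"
    and star_add: "star (x + y) = star x + star y"
    and star_scaleC: "star (c *\<^sub>C x) = cnj c *\<^sub>C star x"
    and star_mult: "star (x * y) = star y * star x"
    and cstar_identity: "norm (star x * x) = (norm x)\<^sup>2"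


section \<open>Bounded operators on a Hilbert space\<close>

lemma cinner_add_left: "cinner (x + y) z = cinner x z + cinner (y::'a::chilbert_space) z"
  by (metis cinner_add_right cinner_commute complex_cnj_add)

lemma cinner_scaleC_left: "cinner (c *\<^sub>C x) y = cnj c * cinner x (y::'a::chilbert_space)"
  by (metis cinner_commute cinner_scaleC_right complex_cnj_mult)

lemma cinner_scaleR_right: "cinner x (r *\<^sub>R y) = of_real r * cinner x (y::'a::chilbert_space)"
  by (metis cinner_scaleC_right scaleC_of_real)

lemma cinner_scaleR_left: "cinner (r *\<^sub>R x) y = of_real r * cinner x (y::'a::chilbert_space)"
  by (metis cinner_scaleC_left scaleC_of_real complex_cnj_complex_of_real)

lemma cinner_zero_right [simp]: "cinner (x::'a::chilbert_space) 0 = 0"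
  using cinner_scaleR_right[of x 0 0] by simp

lemma cinner_zero_left [simp]: "cinner 0 (x::'a::chilbert_space) = 0"
  using cinner_scaleR_left[of 0 0 x] by simp

lemma cinner_minus_right: "cinner x (- y) = - cinner x (y::'a::chilbert_space)"
  using cinner_scaleR_right[of x "-1" y] by simp

lemma cinner_diff_right: "cinner x (y - z) = cinner x y - cinner x (z::'a::chilbert_space)"
  using cinner_add_right[of x y "- z"] by (simp add: cinner_minus_right)

lemma cinner_minus_left: "cinner (- x) y = - cinner x (y::'a::chilbert_space)"
  using cinner_scaleR_left[of "-1" x y] by simp

lemma cinner_diff_left: "cinner (x - y) z = cinner x z - cinner y (z::'a::chilbert_space)"
  using cinner_add_left[of x "- y" z] by (simp add: cinner_minus_left)

lemma norm_add_sq: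
  "(norm (x + y))\<^sup>2 = (norm x)\<^sup>2 + (norm y)\<^sup>2 + 2 * Re (cinner x (y::'a::chilbert_space))"
proof -
  have "(norm (x + y))\<^sup>2 = Re (cinner (x + y) (x + y))"
    by (simp add: cinner_self)
  also have "\<dots> = Re (cinner x x) + Re (cinner y y) + Re (cinner x y) + Re (cinner y x)"
    by (simp add: cinner_add_left cinner_add_right)
  also have "Re (cinner y x) = Re (cinner x y)"
    by (subst cinner_commute) simp
  finally show ?thesis by (simp add: cinner_self)
qed

lemma Re_cinner_le: "Re (cinner x y) \<le> norm x * norm (y::'a::chilbert_space)"
proof -
  have "(norm (x + y))\<^sup>2 \<le> (norm x + norm y)\<^sup>2"
    by (intro power_mono norm_triangle_ineq) auto
  then show ?thesis
    by (simp add: norm_add_sq power2_sum)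
qed

lemma norm_cinner_le: "cmod (cinner x y) \<le> norm x * norm (y::'a::chilbert_space)"
proof (cases "cinner x y = 0")
  case False
  define c where "c = cnj (cinner x y) / cmod (cinner x y)"
  have "cmod c = 1"
    using False by (simp add: c_def norm_divide)
  have "cinner x (c *\<^sub>C y) = cmod (cinner x y)"
    using False by (simp add: c_def cinner_scaleC_right complex_norm_square[symmetric] power2_eq_square
        mult.commute[of "cnj (cinner x y)"])
  then have "cmod (cinner x y) = Re (cinner x (c *\<^sub>C y))"
    by simp
  also have "\<dots> \<le> norm x * norm (c *\<^sub>C y)"
    by (rule Re_cinner_le)
  finally show ?thesis
    by (simp add: norm_scaleC \<open>cmod c = 1\<close>)
qed auto

lemma cinner_ext:
  assumes "\<And>z. cinner x z = cinner (y::'a::chilbert_space) z"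
  shows "x = y"
proof -
  have "cinner (x - y) (x - y) = 0"
    by (simp add: assms cinner_diff_left)
  then show ?thesis by (simp add: cinner_self)
qed

lemma riesz_representation:
  fixes f :: "'a::chilbert_space \<Rightarrow> complex"
  assumes add: "\<And>x y. f (x + y) = f x + f y" and scale: "\<And>c x. f (c *\<^sub>C x) = c * f x"
    and bdd: "\<And>x. cmod (f x) \<le> K * norm x"
  shows "\<exists>y. \<forall>x. f x = cinner y x"
proof -
  define J where "J x = (norm x)\<^sup>2 - 2 * Re (f x)" for x
  have scaleR: "f (r *\<^sub>R x) = of_real r * f x" for r x
    by (metis scale scaleC_of_real)
  have J_bdd: "J x \<ge> - K\<^sup>2" for x
  proof -
    have "Re (f x) \<le> K * norm x"
      using bdd[of x] complex_Re_le_cmod[of "f x"] by linarith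
    moreover have "0 \<le> (norm x - K)\<^sup>2" by simp
    ultimately show ?thesis
      by (simp add: J_def power2_diff mult.commute)
  qed
  define m where "m = (INF x. J x)"
  have m_le: "m \<le> J x" for x
    unfolding m_def by (rule cINF_lower) (auto intro!: bdd_belowI J_bdd)
  have para: "(norm (x - y))\<^sup>2 \<le> 2 * J x + 2 * J y - 4 * m" for x y
  proof -
    have 1: "(norm (x - y))\<^sup>2 = (norm x)\<^sup>2 + (norm y)\<^sup>2 - 2 * Re (cinner x y)"
      using norm_add_sq[of x "- y"] by (simp add: cinner_minus_right)
    have 2: "4 * J ((1/2) *\<^sub>R (x + y)) = (norm (x + y))\<^sup>2 - 4 * Re (f (x + y))"
      by (simp add: J_def scaleR power_mult_distrib power_divide)
    have "4 * m \<le> 4 * J ((1/2) *\<^sub>R (x + y))"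
      using m_le by simp
    then show ?thesis
      unfolding 1 2 norm_add_sq by (simp add: J_def add)
  qed
  have "\<exists>x. J x < m + 1 / real (Suc n)" for n
  proof -
    have "m < m + 1 / real (Suc n)" by simp
    then show ?thesis
      unfolding m_def using cINF_less_iff[of UNIV J]
      by (metis J_bdd UNIV_not_empty bdd_belowI2 UNIV_I)
  qed
  then obtain X where X: "\<And>n. J (X n) < m + 1 / real (Suc n)"
    by metis
  have "Cauchy X"
  proof (rule metric_CauchyI)
    fix e :: real assume "e > 0"
    then obtain N where N: "1 / real (Suc N) < e\<^sup>2 / 4"
      using nat_approx_posE[of "e\<^sup>2 / 4"] by auto
    have "dist (X i) (X j) < e" if "i \<ge> N" "j \<ge> N" for i j
    proof -
      have inv: "1 / real (Suc k) \<le> 1 / real (Suc N)" if "k \<ge> N" for k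
        using that by (simp add: frac_le)
      have "(norm (X i - X j))\<^sup>2 \<le> 2 * J (X i) + 2 * J (X j) - 4 * m"
        by (rule para)
      also have "\<dots> < e\<^sup>2"
        using X[of i] X[of j] inv[OF that(1)] inv[OF that(2)] N by linarith
      finally show ?thesis
        using \<open>e > 0\<close> by (simp add: dist_norm power_less_imp_less_base)
    qed
    then show "\<exists>M. \<forall>m\<ge>M. \<forall>n\<ge>M. dist (X m) (X n) < e"
      by blast
  qed
  then obtain y where y: "X \<longlonglongrightarrow> y"
    using Cauchy_convergent convergent_def by blast
  have bl: "bounded_linear f"
    by (rule bounded_linear_intro[where K = K])
      (auto simp: add scaleR scaleR_conv_of_real bdd mult.commute)
  have "(\<lambda>n. J (X n)) \<longlonglongrightarrow> J y"
    unfolding J_def by (intro tendsto_intros bounded_linear.tendsto[OF bl] y)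
  moreover have "(\<lambda>n. m + 1 / real (Suc n)) \<longlonglongrightarrow> m + 0"
    by (intro tendsto_add tendsto_const LIMSEQ_Suc lim_1_over_n)
  ultimately have "J y \<le> m + 0"
    by (rule LIMSEQ_le) (use X less_imp_le in blast)
  then have min: "J y \<le> J x" for x
    using m_le[of x] by simp
  have Re_eq: "Re (f x) = Re (cinner y x)" for x
  proof (cases "x = 0")
    case True
    then show ?thesis using scaleR[of 0 x] by simp
  next
    case False
    define d where "d = Re (cinner y x) - Re (f x)"
    define t where "t = - d / (norm x)\<^sup>2"
    have "J y \<le> J (y + t *\<^sub>R x)" by (rule min)
    then have "0 \<le> t\<^sup>2 * (norm x)\<^sup>2 + 2 * t * d"
      by (simp add: J_def norm_add_sq add scaleR cinner_scaleR_right d_def power_mult_distrib algebra_simps)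
    also have "\<dots> = - d\<^sup>2 / (norm x)\<^sup>2"
      using False by (simp add: t_def field_simps power2_eq_square)
    finally have "d = 0"
      using False by (simp add: divide_le_0_iff zero_le_divide_iff)
    then show ?thesis by (simp add: d_def)
  qed
  have "f x = cinner y x" for x
  proof (rule complex_eqI)
    show "Re (f x) = Re (cinner y x)" by (rule Re_eq)
    show "Im (f x) = Im (cinner y x)"
      using Re_eq[of "\<i> *\<^sub>C x"] by (simp add: scale cinner_scaleC_right)
  qed
  then show ?thesis by blast
qed

typedef (overloaded) 'h bop =
  "{A :: 'h::chilbert_space \<Rightarrow>\<^sub>L 'h. \<forall>c x. A (c *\<^sub>C x) = c *\<^sub>C A x}"
  morphisms blinfun_of_bop Bop
  by (rule exI[of _ id_blinfun]) simp

setup_lifting type_definition_bop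

lift_definition bop_apply :: "'h::chilbert_space bop \<Rightarrow> 'h \<Rightarrow> 'h" is blinfun_apply .

lemma bop_eqI: "(\<And>x. bop_apply A x = bop_apply B x) \<Longrightarrow> A = B"
  by transfer (rule blinfun_eqI)

lemma bop_exists:
  fixes f :: "'h::chilbert_space \<Rightarrow> 'h"
  assumes "\<And>x y. f (x + y) = f x + f y" "\<And>c x. f (c *\<^sub>C x) = c *\<^sub>C f x"
    and "\<And>x. norm (f x) \<le> K * norm x"
  shows "\<exists>A. \<forall>x. bop_apply A x = f x"
proof -
  have bl: "bounded_linear f"
    by (rule bounded_linear_intro[where K = K])
      (use assms in \<open>auto simp: mult.commute simp flip: scaleC_of_real\<close>)
  have "bop_apply (Bop (Blinfun f)) x = f x" for x
    by (simp add: bop_apply_def Bop_inverse bounded_linear_Blinfun_apply[OF bl] assms)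
  then show ?thesis by blast
qed

lemma adjoint_exists:
  "\<exists>B. \<forall>x y. cinner (bop_apply B x) y = cinner x (bop_apply (A :: 'h::chilbert_space bop) y)"
proof -
  have A_add: "bop_apply A (x + y) = bop_apply A x + bop_apply A y" for x y
    by transfer (rule blinfun.add_right)
  have A_scale: "bop_apply A (c *\<^sub>C x) = c *\<^sub>C bop_apply A x" for c x
    by transfer simp
  define K where "K = norm (blinfun_of_bop A)"
  have A_norm: "norm (bop_apply A x) \<le> K * norm x" for x
    unfolding K_def bop_apply.rep_eq by (rule norm_blinfun)
  have A_cinner: "cmod (cinner x (bop_apply A y)) \<le> (norm x * K) * norm y" for x y
  proof -
    have "cmod (cinner x (bop_apply A y)) \<le> norm x * norm (bop_apply A y)"
      by (rule norm_cinner_le)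
    also have "\<dots> \<le> norm x * (K * norm y)"
      by (intro mult_left_mono A_norm) auto
    finally show ?thesis by (simp add: mult_ac)
  qed
  have "\<exists>z. \<forall>y. cinner x (bop_apply A y) = cinner z y" for x
    by (rule riesz_representation[OF _ _ A_cinner])
      (auto simp: A_add A_scale cinner_add_right cinner_scaleC_right)
  then obtain g where g: "\<And>x y. cinner x (bop_apply A y) = cinner (g x) y"
    by metis
  have "\<exists>B. \<forall>x. bop_apply B x = g x"
  proof (rule bop_exists)
    show "g (x + y) = g x + g y" for x y
      by (rule cinner_ext) (simp add: cinner_add_left flip: g)
    show "g (c *\<^sub>C x) = c *\<^sub>C g x" for c x
      by (rule cinner_ext) (simp add: cinner_scaleC_left flip: g)
    show "norm (g x) \<le> K * norm x" for x
    proof (cases "g x = 0")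
      case False
      have "(norm (g x))\<^sup>2 = cmod (cinner (g x) (g x))"
        by (simp add: cinner_self norm_power)
      also have "\<dots> \<le> (norm x * K) * norm (g x)"
        unfolding g[symmetric] by (rule A_cinner)
      finally show ?thesis
        using False by (simp add: power2_eq_square mult.commute)
    qed (auto simp: K_def)
  qed
  then show ?thesis using g by metis
qed

instantiation bop :: (chilbert_space) complex_normed_vector
begin

lift_definition zero_bop :: "'a bop" is 0 by (simp add: complex_vector.scale_zero_right)
lift_definition plus_bop :: "'a bop \<Rightarrow> 'a bop \<Rightarrow> 'a bop" is "(+)"
  by (simp add: blinfun.add_left scaleC_add_right)
lift_definition uminus_bop :: "'a bop \<Rightarrow> 'a bop" is uminus
  by (simp add: blinfun.minus_left complex_vector.scale_minus_right)
lift_definition minus_bop :: "'a bop \<Rightarrow> 'a bop \<Rightarrow> 'a bop" is "(-)"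
  by (simp add: blinfun.diff_left complex_vector.scale_right_diff_distrib)
lift_definition scaleR_bop :: "real \<Rightarrow> 'a bop \<Rightarrow> 'a bop" is scaleR
  by (simp add: blinfun.scaleR_left scaleC_scaleC mult.commute flip: scaleC_of_real)
lift_definition norm_bop :: "'a bop \<Rightarrow> real" is norm .
lift_definition dist_bop :: "'a bop \<Rightarrow> 'a bop \<Rightarrow> real" is dist .
definition sgn_bop :: "'a bop \<Rightarrow> 'a bop" where
  "sgn_bop A = scaleR (inverse (norm A)) A"
definition uniformity_bop :: "('a bop \<times> 'a bop) filter" where
  "uniformity_bop = (INF e\<in>{0 <..}. principal {(A, B). dist A B < e})"
definition open_bop :: "'a bop set \<Rightarrow> bool" where
  "open_bop S = (\<forall>A\<in>S. \<forall>\<^sub>F (A', B) in uniformity. A' = A \<longrightarrow> B \<in> S)"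

lift_definition scaleC_bop :: "complex \<Rightarrow> 'a bop \<Rightarrow> 'a bop" is
  "\<lambda>c A. Blinfun (\<lambda>x. c *\<^sub>C blinfun_apply A x)"
  subgoal premises prems for c A
  proof -
    have "bounded_linear (\<lambda>x. c *\<^sub>C blinfun_apply A x)"
    proof (rule bounded_linear_intro[where K = "cmod c * norm A"])
      show "c *\<^sub>C blinfun_apply A (r *\<^sub>R x) = r *\<^sub>R (c *\<^sub>C blinfun_apply A x)" for r x
        by (simp add: blinfun.scaleR_right scaleC_scaleR)
      show "norm (c *\<^sub>C blinfun_apply A x) \<le> norm x * (cmod c * norm A)" for x
        using mult_left_mono[OF norm_blinfun[of A x], of "cmod c"] by (simp add: norm_scaleC mult_ac)
    qed (simp add: blinfun.add_right scaleC_add_right)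
    then show ?thesis
      using prems by (simp add: bounded_linear_Blinfun_apply scaleC_scaleC mult.commute)
  qed
  done

lemma bop_apply_scaleC: "bop_apply (c *\<^sub>C A) x = c *\<^sub>C bop_apply A x"
proof transfer
  fix c :: complex and A :: "'a \<Rightarrow>\<^sub>L 'a" and x
  assume "\<forall>c x. blinfun_apply A (c *\<^sub>C x) = c *\<^sub>C blinfun_apply A x"
  have "bounded_linear (\<lambda>x. c *\<^sub>C blinfun_apply A x)"
  proof (rule bounded_linear_intro[where K = "cmod c * norm A"])
    show "c *\<^sub>C blinfun_apply A (r *\<^sub>R x) = r *\<^sub>R (c *\<^sub>C blinfun_apply A x)" for r x
      by (simp add: blinfun.scaleR_right scaleC_scaleR)
    show "norm (c *\<^sub>C blinfun_apply A x) \<le> norm x * (cmod c * norm A)" for x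
      using mult_left_mono[OF norm_blinfun[of A x], of "cmod c"] by (simp add: norm_scaleC mult_ac)
  qed (simp add: blinfun.add_right scaleC_add_right)
  then show "blinfun_apply (Blinfun (\<lambda>x. c *\<^sub>C blinfun_apply A x)) x = c *\<^sub>C blinfun_apply A x"
    by (simp add: bounded_linear_Blinfun_apply)
qed

lemma bop_apply_add: "bop_apply (A + B) x = bop_apply A x + bop_apply B x"
  by transfer (rule blinfun.add_left)

lemma bop_apply_scaleR: "bop_apply (r *\<^sub>R A) x = r *\<^sub>R bop_apply A x"
  by transfer (rule blinfun.scaleR_left)

lemma norm_bop_apply: "norm (bop_apply A x) \<le> norm A * norm x"
  by transfer (rule norm_blinfun)

lemma norm_bop_bound: "0 \<le> b \<Longrightarrow> (\<And>x. norm (bop_apply A x) \<le> b * norm x) \<Longrightarrow> norm A \<le> b"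
  by transfer (rule norm_blinfun_bound)

instance
proof
  fix A B C :: "'a bop" and r s :: real and c d :: complex
  show "A + B + C = A + (B + C)" "A + B = B + A" "0 + A = A" "- A + A = 0" "A - B = A + - B"
    "r *\<^sub>R (A + B) = r *\<^sub>R A + r *\<^sub>R B" "(r + s) *\<^sub>R A = r *\<^sub>R A + s *\<^sub>R A"
    "r *\<^sub>R s *\<^sub>R A = (r * s) *\<^sub>R A" "1 *\<^sub>R A = A"
    by (transfer; simp add: algebra_simps)+
  show "c *\<^sub>C (A + B) = c *\<^sub>C A + c *\<^sub>C B" "(c + d) *\<^sub>C A = c *\<^sub>C A + d *\<^sub>C A"
    "c *\<^sub>C d *\<^sub>C A = (c * d) *\<^sub>C A" "complex_of_real r *\<^sub>C A = r *\<^sub>R A"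
    by (auto intro!: bop_eqI simp: bop_apply_scaleC bop_apply_add bop_apply_scaleR scaleC_add_right
        scaleC_add_left scaleC_scaleC scaleC_of_real)
  show "dist A B = norm (A - B)" by transfer (rule dist_norm)
  show "sgn A = scaleR (inverse (norm A)) A" by (rule sgn_bop_def)
  show "uniformity = (INF e\<in>{0 <..}. principal {(A, B :: 'a bop). dist A B < e})"
    by (rule uniformity_bop_def)
  show "open S = (\<forall>A\<in>S. \<forall>\<^sub>F (A', B) in uniformity. A' = A \<longrightarrow> B \<in> S)" for S :: "'a bop set"
    by (rule open_bop_def)
  show "(norm A = 0) = (A = 0)" by transfer simp
  show "norm (A + B) \<le> norm A + norm B" by transfer (rule norm_triangle_ineq)
  show "norm (r *\<^sub>R A) = \<bar>r\<bar> * norm A" by transfer simp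
  show "norm (c *\<^sub>C A) = cmod c * norm A"
  proof (rule antisym)
    have le: "norm (c *\<^sub>C A) \<le> cmod c * norm A" for c and A :: "'a bop"
    proof (rule norm_bop_bound)
      fix x
      show "norm (bop_apply (c *\<^sub>C A) x) \<le> cmod c * norm A * norm x"
        using mult_left_mono[OF norm_bop_apply[of A x], of "cmod c"]
        by (simp add: bop_apply_scaleC norm_scaleC mult.assoc)
    next
      show "0 \<le> cmod c * norm A" by transfer simp
    qed
    show "norm (c *\<^sub>C A) \<le> cmod c * norm A" by (rule le)
    show "cmod c * norm A \<le> norm (c *\<^sub>C A)"
    proof (cases "c = 0")
      case False
      have "A = inverse c *\<^sub>C c *\<^sub>C A"
        using False by (auto intro!: bop_eqI simp: bop_apply_scaleC)
      then have "norm A \<le> cmod (inverse c) * norm (c *\<^sub>C A)"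
        using le by metis
      then show ?thesis
        using False by (simp add: norm_inverse norm_divide field_simps)
    next
      case True
      have "0 \<le> norm (c *\<^sub>C A)" by transfer simp
      then show ?thesis using True by simp
    qed
  qed
qed

end

instance bop :: (chilbert_space) banach
proof
  fix X :: "nat \<Rightarrow> 'a bop"
  assume X: "Cauchy X"
  have "Cauchy (\<lambda>n. blinfun_of_bop (X n))"
    using X unfolding Cauchy_def by (simp add: dist_bop.rep_eq)
  then obtain L where L: "(\<lambda>n. blinfun_of_bop (X n)) \<longlonglongrightarrow> L"
    unfolding Cauchy_convergent_iff convergent_def by (elim exE)
  have pt: "(\<lambda>n. blinfun_of_bop (X n) x) \<longlonglongrightarrow> L x" for x
    by (rule blinfun.tendsto[OF L tendsto_const])
  have "L (c *\<^sub>C x) = c *\<^sub>C L x" for c x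
  proof -
    have "bounded_linear ((*\<^sub>C) c :: 'a \<Rightarrow> 'a)"
      by (rule bounded_linear_intro[where K = "cmod c"])
        (auto simp: scaleC_add_right norm_scaleC scaleC_scaleC mult.commute simp flip: scaleC_of_real)
    from bounded_linear.tendsto[OF this pt[of x]]
    moreover have "blinfun_of_bop (X n) (c *\<^sub>C x) = c *\<^sub>C blinfun_of_bop (X n) x" for n
      using blinfun_of_bop[of "X n"] by simp
    ultimately have "(\<lambda>n. blinfun_of_bop (X n) (c *\<^sub>C x)) \<longlonglongrightarrow> c *\<^sub>C L x"
      by simp
    then show ?thesis
      using pt LIMSEQ_unique by blast
  qed
  then have "blinfun_of_bop (Bop L) = L"
    by (simp add: Bop_inverse)
  then have "X \<longlonglongrightarrow> Bop L"
    using L by (simp add: tendsto_iff dist_bop.rep_eq)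
  then show "convergent X"
    by (auto simp: convergent_def)
qed

instantiation bop :: ("{chilbert_space, perfect_space}") cstar_algebra
begin

lift_definition one_bop :: "'a bop" is id_blinfun by simp
lift_definition times_bop :: "'a bop \<Rightarrow> 'a bop \<Rightarrow> 'a bop" is blinfun_compose by simp
definition star_bop :: "'a bop \<Rightarrow> 'a bop" where
  "star_bop A = (THE B. \<forall>x y. cinner (bop_apply B x) y = cinner x (bop_apply A y))"

lemma bop_apply_one [simp]: "bop_apply 1 x = x"
  by transfer simp

lemma bop_apply_mult: "bop_apply (A * B) x = bop_apply A (bop_apply B x)"
  by transfer simp

lemma star_bop: "cinner (bop_apply (star A) x) y = cinner x (bop_apply A y)"
proof -
  obtain B where B: "\<forall>x y. cinner (bop_apply B x) y = cinner x (bop_apply A y)"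
    using adjoint_exists[of A] by (elim exE)
  have "star A = B"
    unfolding star_bop_def
  proof (rule the_equality, rule B)
    fix C :: "'a bop"
    assume C: "\<forall>x y. cinner (bop_apply C x) y = cinner x (bop_apply A y)"
    show "C = B"
    proof (rule bop_eqI, rule cinner_ext)
      show "cinner (bop_apply C x) y = cinner (bop_apply B x) y" for x y
        by (simp only: B[rule_format] C[rule_format])
    qed
  qed
  with B show ?thesis by simp
qed

lemma star_bop_right: "cinner x (bop_apply (star A) y) = cinner (bop_apply A x) y"
proof -
  have "cinner x (bop_apply (star A) y) = cnj (cinner (bop_apply (star A) y) x)"
    by (rule cinner_commute)
  also have "\<dots> = cnj (cinner y (bop_apply A x))"
    by (simp only: star_bop)
  also have "\<dots> = cinner (bop_apply A x) y"
    by (rule cinner_commute[symmetric])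
  finally show ?thesis .
qed

lemma star_bop_eqI:
  assumes "\<And>x y. cinner (bop_apply B x) y = cinner x (bop_apply A y)"
  shows "star A = B"
proof (rule bop_eqI, rule cinner_ext)
  show "cinner (bop_apply (star A) x) y = cinner (bop_apply B x) y" for x y
    by (simp only: star_bop assms)
qed

instance
proof
  fix A B C :: "'a bop" and r :: real and c :: complex
  have add: "bop_apply A (x + y) = bop_apply A x + bop_apply A y" for A :: "'a bop" and x y
    by transfer (rule blinfun.add_right)
  have scaleC: "bop_apply A (c *\<^sub>C x) = c *\<^sub>C bop_apply A x" for A :: "'a bop" and c x
    by transfer simp
  show "A * B * C = A * (B * C)" "1 * A = A" "A * 1 = A"
    "(A + B) * C = A * C + B * C" "A * (B + C) = A * B + A * C"
    "(c *\<^sub>C A) * B = c *\<^sub>C (A * B)" "A * (c *\<^sub>C B) = c *\<^sub>C (A * B)"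
    by (auto intro!: bop_eqI simp: bop_apply_mult bop_apply_add bop_apply_scaleC add scaleC)
  show "(r *\<^sub>R A) * B = r *\<^sub>R (A * B)" "A * (r *\<^sub>R B) = r *\<^sub>R (A * B)"
    by (auto intro!: bop_eqI simp: bop_apply_mult bop_apply_scaleC add scaleC simp flip: scaleC_of_real)
  show norm1: "norm (1 :: 'a bop) = 1"
    by transfer simp
  show "(0 :: 'a bop) \<noteq> 1"
    using norm1 by (metis norm_zero zero_neq_one)
  show mult: "norm (A * B) \<le> norm A * norm B" for A B :: "'a bop"
    by transfer (rule norm_blinfun_compose)
  show "star (star A) = A"
    by (rule star_bop_eqI) (simp add: star_bop_right)
  show "star (A + B) = star A + star B"
    by (rule star_bop_eqI) (simp add: bop_apply_add cinner_add_left cinner_add_right star_bop)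
  show "star (c *\<^sub>C A) = cnj c *\<^sub>C star A"
    by (rule star_bop_eqI) (simp add: bop_apply_scaleC cinner_scaleC_left cinner_scaleC_right star_bop)
  show "star (A * B) = star B * star A"
    by (rule star_bop_eqI) (simp add: bop_apply_mult star_bop)
  have le: "(norm A)\<^sup>2 \<le> norm (star A * A)" for A :: "'a bop"
  proof -
    have "norm A \<le> sqrt (norm (star A * A))"
    proof (rule norm_bop_bound)
      fix x
      have "(norm (bop_apply A x))\<^sup>2 = cmod (cinner (bop_apply A x) (bop_apply A x))"
        by (simp add: cinner_self norm_power)
      also have "\<dots> = cmod (cinner (bop_apply (star A * A) x) x)"
        by (simp add: bop_apply_mult star_bop)
      also have "\<dots> \<le> norm (bop_apply (star A * A) x) * norm x"
        by (rule norm_cinner_le)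
      also have "\<dots> \<le> norm (star A * A) * norm x * norm x"
        by (intro mult_right_mono norm_bop_apply) auto
      also have "\<dots> = (sqrt (norm (star A * A)) * norm x)\<^sup>2"
        by (simp add: power_mult_distrib power2_eq_square)
      finally show "norm (bop_apply A x) \<le> sqrt (norm (star A * A)) * norm x"
        by (rule power2_le_imp_le) simp
    qed simp
    then have "(norm A)\<^sup>2 \<le> (sqrt (norm (star A * A)))\<^sup>2"
      by (intro power_mono) auto
    then show ?thesis by simp
  qed
  have star_le: "norm A \<le> norm (star A)" for A :: "'a bop"
  proof (cases "A = 0")
    case False
    have "norm A * norm A \<le> norm (star A) * norm A"
      using le[of A] mult[of "star A" A] by (simp add: power2_eq_square)
    with False show ?thesis by simp
  qed auto
  have "norm (star A) \<le> norm A"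
    using star_le[of "star A"] \<open>star (star A) = A\<close> by simp
  then have "norm (star A * A) \<le> (norm A)\<^sup>2"
    using mult[of "star A" A] mult_right_mono[of "norm (star A)" "norm A" "norm A"]
    by (simp add: power2_eq_square)
  with le[of A] show "norm (star A * A) = (norm A)\<^sup>2" by simp
qed

end


section \<open>Square-summable families\<close>

typedef 'i ell2 = "{x :: 'i \<Rightarrow> complex. (\<lambda>i. (cmod (x i))\<^sup>2) summable_on UNIV}"
  morphisms ell2_coeff Abs_ell2
  by (rule exI[of _ "\<lambda>_. 0"]) simp

setup_lifting type_definition_ell2

lemma ell2_coeff_summable: "(\<lambda>i. (cmod (ell2_coeff x i))\<^sup>2) summable_on UNIV"
  using ell2_coeff[of x] by simp

lemma ell2_eqI: "(\<And>i. ell2_coeff x i = ell2_coeff y i) \<Longrightarrow> x = y"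
  by (simp add: ext flip: ell2_coeff_inject)

lemma square_summableI:
  fixes x :: "'i \<Rightarrow> complex"
  assumes "\<And>F. finite F \<Longrightarrow> L2_set (\<lambda>i. cmod (x i)) F \<le> b"
  shows "(\<lambda>i. (cmod (x i))\<^sup>2) summable_on UNIV"
    and "sqrt (\<Sum>\<^sub>\<infinity>i. (cmod (x i))\<^sup>2) \<le> b"
proof -
  have b: "0 \<le> b" using assms[of "{}"] by simp
  have le: "(\<Sum>i\<in>F. (cmod (x i))\<^sup>2) \<le> b\<^sup>2" if "finite F" for F
    using assms[OF that] unfolding L2_set_def by (rule sqrt_le_D)
  show sm: "(\<lambda>i. (cmod (x i))\<^sup>2) summable_on UNIV"
    by (rule nonneg_bdd_above_summable_on) (auto intro!: bdd_aboveI[of _ "b\<^sup>2"] le)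
  have "(\<Sum>\<^sub>\<infinity>i. (cmod (x i))\<^sup>2) \<le> b\<^sup>2"
    by (rule infsum_le_finite_sums[OF sm]) (rule le)
  then show "sqrt (\<Sum>\<^sub>\<infinity>i. (cmod (x i))\<^sup>2) \<le> b"
    using b by (simp add: real_le_lsqrt)
qed

lemma L2_set_le_infsum:
  assumes "(\<lambda>i. (cmod (x i))\<^sup>2) summable_on UNIV" "finite F"
  shows "L2_set (\<lambda>i. cmod (x i)) F \<le> sqrt (\<Sum>\<^sub>\<infinity>i. (cmod (x i))\<^sup>2)"
  unfolding L2_set_def
  by (intro real_sqrt_le_mono finite_sum_le_infsum) (use assms in auto)

lemma L2_set_cmod_add:
  "L2_set (\<lambda>i. cmod (x i + y i)) F \<le> L2_set (\<lambda>i. cmod (x i)) F + L2_set (\<lambda>i. cmod (y i)) F"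
proof -
  have "L2_set (\<lambda>i. cmod (x i + y i)) F \<le> L2_set (\<lambda>i. cmod (x i) + cmod (y i)) F"
    by (rule L2_set_mono) (auto intro: norm_triangle_ineq)
  also have "\<dots> \<le> L2_set (\<lambda>i. cmod (x i)) F + L2_set (\<lambda>i. cmod (y i)) F"
    by (rule L2_set_triangle_ineq)
  finally show ?thesis .
qed

lemma L2_set_cmod_mult:
  "L2_set (\<lambda>i. cmod (c * x i)) F = cmod c * L2_set (\<lambda>i. cmod (x i)) F"
  by (simp add: norm_mult L2_set_right_distrib)

lemma square_summable_add:
  assumes "(\<lambda>i. (cmod (x i))\<^sup>2) summable_on UNIV" "(\<lambda>i. (cmod (y i))\<^sup>2) summable_on UNIV"
  shows "(\<lambda>i. (cmod (x i + y i))\<^sup>2) summable_on UNIV"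
    and "sqrt (\<Sum>\<^sub>\<infinity>i. (cmod (x i + y i))\<^sup>2)
      \<le> sqrt (\<Sum>\<^sub>\<infinity>i. (cmod (x i))\<^sup>2) + sqrt (\<Sum>\<^sub>\<infinity>i. (cmod (y i))\<^sup>2)"
proof -
  have "L2_set (\<lambda>i. cmod (x i + y i)) F
      \<le> sqrt (\<Sum>\<^sub>\<infinity>i. (cmod (x i))\<^sup>2) + sqrt (\<Sum>\<^sub>\<infinity>i. (cmod (y i))\<^sup>2)" if "finite F" for F
    using L2_set_cmod_add[of x y F] L2_set_le_infsum[OF assms(1) that]
      L2_set_le_infsum[OF assms(2) that] by linarith
  from square_summableI[OF this] show "(\<lambda>i. (cmod (x i + y i))\<^sup>2) summable_on UNIV"
    and "sqrt (\<Sum>\<^sub>\<infinity>i. (cmod (x i + y i))\<^sup>2)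
      \<le> sqrt (\<Sum>\<^sub>\<infinity>i. (cmod (x i))\<^sup>2) + sqrt (\<Sum>\<^sub>\<infinity>i. (cmod (y i))\<^sup>2)" by blast+
qed

lemma square_summable_mult:
  assumes "(\<lambda>i. (cmod (x i))\<^sup>2) summable_on UNIV"
  shows "(\<lambda>i. (cmod (c * x i))\<^sup>2) summable_on UNIV"
    and "sqrt (\<Sum>\<^sub>\<infinity>i. (cmod (c * x i))\<^sup>2) = cmod c * sqrt (\<Sum>\<^sub>\<infinity>i. (cmod (x i))\<^sup>2)"
  using assms
  by (simp_all add: norm_mult power_mult_distrib summable_on_cmult_right infsum_cmult_right' real_sqrt_mult)

instantiation ell2 :: (type) complex_normed_vector
begin

lift_definition zero_ell2 :: "'a ell2" is "\<lambda>_. 0" by simp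
lift_definition plus_ell2 :: "'a ell2 \<Rightarrow> 'a ell2 \<Rightarrow> 'a ell2" is "\<lambda>x y i. x i + y i"
  by (rule square_summable_add)
lift_definition uminus_ell2 :: "'a ell2 \<Rightarrow> 'a ell2" is "\<lambda>x i. - x i" by simp
definition minus_ell2 :: "'a ell2 \<Rightarrow> 'a ell2 \<Rightarrow> 'a ell2" where
  "minus_ell2 x y = x + - y"
lift_definition scaleC_ell2 :: "complex \<Rightarrow> 'a ell2 \<Rightarrow> 'a ell2" is "\<lambda>c x i. c * x i"
  by (rule square_summable_mult)
definition scaleR_ell2 :: "real \<Rightarrow> 'a ell2 \<Rightarrow> 'a ell2" where
  "scaleR_ell2 r x = scaleC (complex_of_real r) x"
lift_definition norm_ell2 :: "'a ell2 \<Rightarrow> real" is "\<lambda>x. sqrt (\<Sum>\<^sub>\<infinity>i. (cmod (x i))\<^sup>2)" .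
definition dist_ell2 :: "'a ell2 \<Rightarrow> 'a ell2 \<Rightarrow> real" where
  "dist_ell2 x y = norm (x - y)"
definition sgn_ell2 :: "'a ell2 \<Rightarrow> 'a ell2" where
  "sgn_ell2 x = scaleR (inverse (norm x)) x"
definition uniformity_ell2 :: "('a ell2 \<times> 'a ell2) filter" where
  "uniformity_ell2 = (INF e\<in>{0 <..}. principal {(x, y). dist x y < e})"
definition open_ell2 :: "'a ell2 set \<Rightarrow> bool" where
  "open_ell2 S = (\<forall>x\<in>S. \<forall>\<^sub>F (x', y) in uniformity. x' = x \<longrightarrow> y \<in> S)"

instance
proof
  fix x y z :: "'a ell2" and r s :: real and c d :: complex
  show "x + y + z = x + (y + z)" by transfer (simp add: add.assoc)
  show "x + y = y + x" by transfer (simp add: add.commute)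
  show "0 + x = x" by transfer simp
  show "- x + x = 0" by transfer simp
  show "x - y = x + - y" by (rule minus_ell2_def)
  show add_right: "c *\<^sub>C (x + y) = c *\<^sub>C x + c *\<^sub>C y" for c by transfer (simp add: distrib_left)
  show add_left: "(c + d) *\<^sub>C x = c *\<^sub>C x + d *\<^sub>C x" for c d by transfer (simp add: distrib_right)
  show scaleC: "c *\<^sub>C d *\<^sub>C x = (c * d) *\<^sub>C x" for c d by transfer (simp add: mult.assoc)
  show "complex_of_real r *\<^sub>C x = scaleR r x" by (simp only: scaleR_ell2_def)
  show "scaleR r (x + y) = scaleR r x + scaleR r y" by (simp only: scaleR_ell2_def add_right)
  show "scaleR (r + s) x = scaleR r x + scaleR s x" by (simp only: scaleR_ell2_def add_left of_real_add)
  show "scaleR r (scaleR s x) = scaleR (r * s) x" by (simp only: scaleR_ell2_def scaleC of_real_mult)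
  show "scaleR 1 x = x" unfolding scaleR_ell2_def by transfer simp
  show "dist x y = norm (x - y)" by (rule dist_ell2_def)
  show "sgn x = scaleR (inverse (norm x)) x" by (rule sgn_ell2_def)
  show "uniformity = (INF e\<in>{0 <..}. principal {(x, y :: 'a ell2). dist x y < e})"
    by (rule uniformity_ell2_def)
  show "open S = (\<forall>x\<in>S. \<forall>\<^sub>F (x', y) in uniformity. x' = x \<longrightarrow> y \<in> S)" for S :: "'a ell2 set"
    by (rule open_ell2_def)
  show "(norm x = 0) = (x = 0)"
  proof transfer
    fix x :: "'a \<Rightarrow> complex"
    assume sm: "(\<lambda>i. (cmod (x i))\<^sup>2) summable_on UNIV"
    show "(sqrt (\<Sum>\<^sub>\<infinity>i. (cmod (x i))\<^sup>2) = 0) = (x = (\<lambda>_. 0))"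
    proof
      assume "sqrt (\<Sum>\<^sub>\<infinity>i. (cmod (x i))\<^sup>2) = 0"
      then have "(\<Sum>\<^sub>\<infinity>i. (cmod (x i))\<^sup>2) \<le> 0" by simp
      from nonneg_infsum_le_0D[OF this sm] show "x = (\<lambda>_. 0)" by auto
    qed simp
  qed
  show "norm (x + y) \<le> norm x + norm y"
    by transfer (rule square_summable_add)
  show norm: "norm (c *\<^sub>C x) = cmod c * norm x" for c
    by transfer (rule square_summable_mult)
  show "norm (scaleR r x) = \<bar>r\<bar> * norm x"
    by (simp only: scaleR_ell2_def norm norm_of_real)
qed

end

lemma ell2_coeff_simps [simp]:
  "ell2_coeff 0 i = 0" "ell2_coeff (x + y) i = ell2_coeff x i + ell2_coeff y i"
  "ell2_coeff (c *\<^sub>C x) i = c * ell2_coeff x i" "ell2_coeff (x - y) i = ell2_coeff x i - ell2_coeff y i"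
  unfolding minus_ell2_def zero_ell2.rep_eq plus_ell2.rep_eq scaleC_ell2.rep_eq uminus_ell2.rep_eq
  by simp_all

lemma L2_set_le_norm_ell2: "finite F \<Longrightarrow> L2_set (\<lambda>i. cmod (ell2_coeff x i)) F \<le> norm x"
  unfolding norm_ell2.rep_eq by (rule L2_set_le_infsum[OF ell2_coeff_summable])

lemma norm_ell2_le:
  "(\<And>F. finite F \<Longrightarrow> L2_set (\<lambda>i. cmod (ell2_coeff x i)) F \<le> b) \<Longrightarrow> norm x \<le> b"
  unfolding norm_ell2.rep_eq by (rule square_summableI)

lemma ell2_exists:
  assumes "\<And>F. finite F \<Longrightarrow> L2_set (\<lambda>i. cmod (f i)) F \<le> b"
  obtains x where "ell2_coeff x = f" "norm x \<le> b"
proof -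
  have "(\<lambda>i. (cmod (f i))\<^sup>2) summable_on UNIV"
    by (rule square_summableI[OF assms])
  then have "ell2_coeff (Abs_ell2 f) = f" by (simp add: Abs_ell2_inverse)
  moreover from this have "norm (Abs_ell2 f) \<le> b"
    using assms by (intro norm_ell2_le) simp
  ultimately show ?thesis using that by blast
qed

lemma cmod_ell2_coeff_le: "cmod (ell2_coeff x i) \<le> norm x"
  using L2_set_le_norm_ell2[of "{i}" x] by simp

instance ell2 :: (type) banach
proof
  fix X :: "nat \<Rightarrow> 'a ell2"
  assume X: "Cauchy X"
  have "\<exists>l. (\<lambda>n. ell2_coeff (X n) i) \<longlonglongrightarrow> l" for i
  proof -
    have "Cauchy (\<lambda>n. ell2_coeff (X n) i)"
    proof (rule metric_CauchyI)
      fix e :: real assume "0 < e"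
      then obtain N where N: "\<forall>m\<ge>N. \<forall>n\<ge>N. dist (X m) (X n) < e"
        using metric_CauchyD[OF X] by blast
      have "dist (ell2_coeff (X m) i) (ell2_coeff (X n) i) < e" if "m \<ge> N" "n \<ge> N" for m n
        using cmod_ell2_coeff_le[of "X m - X n" i] N[rule_format, OF that] by (simp add: dist_norm)
      then show "\<exists>M. \<forall>m\<ge>M. \<forall>n\<ge>M. dist (ell2_coeff (X m) i) (ell2_coeff (X n) i) < e"
        by blast
    qed
    then show ?thesis
      by (simp add: Cauchy_convergent_iff convergent_def)
  qed
  then obtain l where l: "\<And>i. (\<lambda>n. ell2_coeff (X n) i) \<longlonglongrightarrow> l i" by metis
  have approx: "\<exists>N. \<forall>m\<ge>N. \<forall>F. finite F \<longrightarrow> L2_set (\<lambda>i. cmod (ell2_coeff (X m) i - l i)) F \<le> e"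
    if e: "0 < e" for e
  proof -
    obtain N where N: "\<forall>m\<ge>N. \<forall>n\<ge>N. dist (X m) (X n) < e"
      using metric_CauchyD[OF X e] by blast
    have "L2_set (\<lambda>i. cmod (ell2_coeff (X m) i - l i)) F \<le> e" if "m \<ge> N" "finite F" for m F
    proof (rule LIMSEQ_le_const2)
      show "(\<lambda>n. L2_set (\<lambda>i. cmod (ell2_coeff (X m) i - ell2_coeff (X n) i)) F)
          \<longlonglongrightarrow> L2_set (\<lambda>i. cmod (ell2_coeff (X m) i - l i)) F"
        unfolding L2_set_def by (intro tendsto_intros l)
      have "L2_set (\<lambda>i. cmod (ell2_coeff (X m) i - ell2_coeff (X n) i)) F \<le> e" if "n \<ge> N" for n
        using L2_set_le_norm_ell2[OF \<open>finite F\<close>, of "X m - X n"]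
          N[rule_format, OF \<open>m \<ge> N\<close> that] by (simp add: dist_norm)
      then show "\<exists>N. \<forall>n\<ge>N. L2_set (\<lambda>i. cmod (ell2_coeff (X m) i - ell2_coeff (X n) i)) F \<le> e"
        by blast
    qed
    then show ?thesis by blast
  qed
  obtain N where N: "\<forall>F. finite F \<longrightarrow> L2_set (\<lambda>i. cmod (ell2_coeff (X N) i - l i)) F \<le> 1"
    using approx[of 1] by auto
  then obtain d where d: "ell2_coeff d = (\<lambda>i. ell2_coeff (X N) i - l i)"
    using ell2_exists[of "\<lambda>i. ell2_coeff (X N) i - l i" 1] by metis
  define L where "L = X N - d"
  have L: "ell2_coeff L i = l i" for i
    by (simp add: L_def d)
  have "X \<longlonglongrightarrow> L"
  proof (rule metric_LIMSEQ_I)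
    fix e :: real assume "0 < e"
    then obtain N where N: "\<forall>m\<ge>N. \<forall>F. finite F \<longrightarrow> L2_set (\<lambda>i. cmod (ell2_coeff (X m) i - l i)) F \<le> e / 2"
      using approx[of "e / 2"] by auto
    have "dist (X m) L < e" if "m \<ge> N" for m
    proof -
      have "norm (X m - L) \<le> e / 2"
        using N that by (intro norm_ell2_le) (simp add: L)
      then show ?thesis using \<open>0 < e\<close> by (simp add: dist_norm)
    qed
    then show "\<exists>no. \<forall>n\<ge>no. dist (X n) L < e" by blast
  qed
  then show "convergent X" by (auto simp: convergent_def)
qed

lemma ell2_cinner_summable: "(\<lambda>i. cnj (ell2_coeff x i) * ell2_coeff y i) summable_on UNIV"
proof (rule abs_summable_summable,
    rule summable_on_comparison_test[where f = "\<lambda>i. (cmod (ell2_coeff x i))\<^sup>2 + (cmod (ell2_coeff y i))\<^sup>2"])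
  show "(\<lambda>i. (cmod (ell2_coeff x i))\<^sup>2 + (cmod (ell2_coeff y i))\<^sup>2) summable_on UNIV"
    by (rule summable_on_add[OF ell2_coeff_summable[of x] ell2_coeff_summable[of y]])
  show "norm (cnj (ell2_coeff x i) * ell2_coeff y i) \<le> (cmod (ell2_coeff x i))\<^sup>2 + (cmod (ell2_coeff y i))\<^sup>2"
    for i
  proof -
    have "2 * cmod (ell2_coeff x i) * cmod (ell2_coeff y i) \<le> (cmod (ell2_coeff x i))\<^sup>2 + (cmod (ell2_coeff y i))\<^sup>2"
      by (rule sum_squares_bound)
    moreover have "0 \<le> cmod (ell2_coeff x i) * cmod (ell2_coeff y i)" by simp
    ultimately show ?thesis unfolding norm_mult complex_mod_cnj by linarith
  qed
qed simp

instantiation ell2 :: (type) chilbert_space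
begin

definition cinner_ell2 :: "'a ell2 \<Rightarrow> 'a ell2 \<Rightarrow> complex" where
  "cinner_ell2 x y = (\<Sum>\<^sub>\<infinity>i. cnj (ell2_coeff x i) * ell2_coeff y i)"

instance
proof
  fix x y z :: "'a ell2" and c :: complex
  show "cinner x y = cnj (cinner y x)"
    unfolding cinner_ell2_def infsum_cnj[symmetric] by (simp add: mult.commute)
  show "cinner x (y + z) = cinner x y + cinner x z"
    by (simp add: cinner_ell2_def distrib_left infsum_add ell2_cinner_summable)
  show "cinner x (c *\<^sub>C y) = c * cinner x y"
    by (simp add: cinner_ell2_def mult.left_commute infsum_cmult_right')
  have "cinner x x = (\<Sum>\<^sub>\<infinity>i. complex_of_real ((cmod (ell2_coeff x i))\<^sup>2))"
    unfolding cinner_ell2_def complex_norm_square by (simp add: mult.commute)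
  also have "\<dots> = complex_of_real (\<Sum>\<^sub>\<infinity>i. (cmod (ell2_coeff x i))\<^sup>2)"
    by (rule infsumI, subst has_sum_of_real_iff) (rule has_sum_infsum[OF ell2_coeff_summable])
  also have "(\<Sum>\<^sub>\<infinity>i. (cmod (ell2_coeff x i))\<^sup>2) = (norm x)\<^sup>2"
    by (simp add: norm_ell2.rep_eq infsum_nonneg)
  finally show "cinner x x = complex_of_real ((norm x)\<^sup>2)" .
qed

end

lift_definition ell2_basis :: "'i \<Rightarrow> 'i ell2" is "\<lambda>i j. if i = j then 1 else 0"
proof -
  fix i :: 'i
  have "(\<lambda>j. (cmod (if i = j then 1 else 0 :: complex))\<^sup>2) summable_on UNIV \<longleftrightarrow>
      (\<lambda>j. (cmod (if i = j then 1 else 0 :: complex))\<^sup>2) summable_on {i}"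
    by (rule summable_on_cong_neutral) auto
  then show "(\<lambda>j. (cmod (if i = j then 1 else 0))\<^sup>2) summable_on UNIV"
    by simp
qed

lemma cinner_ell2_basis: "cinner x (ell2_basis i) = cnj (ell2_coeff x i)"
proof -
  have "cinner x (ell2_basis i) = infsum (\<lambda>j. cnj (ell2_coeff x j) * ell2_coeff (ell2_basis i) j) {i}"
    unfolding cinner_ell2_def by (rule infsum_cong_neutral) (auto simp: ell2_basis.rep_eq)
  then show ?thesis by (simp add: ell2_basis.rep_eq)
qed

instance ell2 :: (type) perfect_space
proof
  fix a :: "'a ell2"
  show "\<not> open {a}"
  proof
    assume "open {a}"
    then obtain e where e: "e > 0" "\<And>y. dist y a < e \<Longrightarrow> y = a"
      unfolding open_dist by auto
    define v :: "'a ell2" where "v = ell2_basis undefined"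
    have "ell2_coeff v undefined = 1" by (simp add: v_def ell2_basis.rep_eq)
    then have "v \<noteq> 0" by auto
    then have "dist (a + (e / 2 / norm v) *\<^sub>R v) a < e"
      using e(1) by (simp add: dist_norm)
    from e(2)[OF this] show False
      using e(1) \<open>v \<noteq> 0\<close> by simp
  qed
qed


section \<open>The tensor product of operators\<close>

lift_definition tensor_vec :: "'i ell2 \<Rightarrow> 'j ell2 \<Rightarrow> ('i \<times> 'j) ell2" is
  "\<lambda>x y (i, j). x i * y j"
proof -
  fix x :: "'i \<Rightarrow> complex" and y :: "'j \<Rightarrow> complex"
  assume x: "(\<lambda>i. (cmod (x i))\<^sup>2) summable_on UNIV" and y: "(\<lambda>j. (cmod (y j))\<^sup>2) summable_on UNIV"
  let ?B = "(\<Sum>\<^sub>\<infinity>i. (cmod (x i))\<^sup>2) * (\<Sum>\<^sub>\<infinity>j. (cmod (y j))\<^sup>2)"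
  have "(\<Sum>p\<in>F. (cmod (case p of (i, j) \<Rightarrow> x i * y j))\<^sup>2) \<le> ?B" if "finite F" for F
  proof -
    have "(\<Sum>p\<in>F. (cmod (case p of (i, j) \<Rightarrow> x i * y j))\<^sup>2)
        \<le> (\<Sum>p\<in>fst ` F \<times> snd ` F. (cmod (case p of (i, j) \<Rightarrow> x i * y j))\<^sup>2)"
      using that by (intro sum_mono2) (auto simp: rev_image_eqI)
    also have "\<dots> = (\<Sum>i\<in>fst ` F. (cmod (x i))\<^sup>2) * (\<Sum>j\<in>snd ` F. (cmod (y j))\<^sup>2)"
      by (simp add: sum_product sum.cartesian_product norm_mult power_mult_distrib case_prod_unfold)
    also have "\<dots> \<le> ?B"
      using that by (intro mult_mono finite_sum_le_infsum x y infsum_nonneg sum_nonneg) auto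
    finally show ?thesis .
  qed
  then show "(\<lambda>p. (cmod (case p of (i, j) \<Rightarrow> x i * y j))\<^sup>2) summable_on UNIV"
    by (intro nonneg_bdd_above_summable_on) (auto intro!: bdd_aboveI[of _ ?B])
qed

lemma ell2_coeff_tensor_vec: "ell2_coeff (tensor_vec x y) (i, j) = ell2_coeff x i * ell2_coeff y j"
  by (simp add: tensor_vec.rep_eq)

lemma bop_linear:
  "bop_apply A (x + y) = bop_apply A x + bop_apply A y" "bop_apply A (c *\<^sub>C x) = c *\<^sub>C bop_apply A x"
  by (transfer; simp add: blinfun.add_right)+

lemma slice_exists:
  fixes g :: "'b \<Rightarrow> 'k"
  assumes "inj g"
  obtains x where "ell2_coeff x = (\<lambda>b. ell2_coeff X (g b))"
proof (rule ell2_exists)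
  fix F :: "'b set"
  assume "finite F"
  have "L2_set (\<lambda>b. cmod (ell2_coeff X (g b))) F = L2_set (\<lambda>k. cmod (ell2_coeff X k)) (g ` F)"
    unfolding L2_set_def using assms by (subst sum.reindex) (auto intro: inj_on_subset)
  also have "\<dots> \<le> norm X"
    using \<open>finite F\<close> by (intro L2_set_le_norm_ell2) simp
  finally show "L2_set (\<lambda>b. cmod (ell2_coeff X (g b))) F \<le> norm X" .
qed (use that in blast)

lemma amplification_exists:
  fixes p :: "'a \<times> 'b \<Rightarrow> 'k" and T :: "'b ell2 bop"
  assumes "bij p"
  shows "\<exists>A :: 'k ell2 bop. norm A \<le> norm T \<and> (\<forall>X x a b. (\<forall>b. ell2_coeff x b = ell2_coeff X (p (a, b))) \<longrightarrow>
    ell2_coeff (bop_apply A X) (p (a, b)) = ell2_coeff (bop_apply T x) b)"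
proof -
  have inj: "inj (\<lambda>b. p (a, b))" for a
    using assms by (auto simp: inj_def bij_def)
  have "\<exists>x. \<forall>b. ell2_coeff x b = ell2_coeff X (p (a, b))" for X a
    using slice_exists[OF inj] by metis
  then obtain row where row: "\<And>X a b. ell2_coeff (row X a) b = ell2_coeff X (p (a, b))"
    by metis
  have "(\<Sum>k\<in>F. (cmod (ell2_coeff (bop_apply T (row X (fst (inv p k)))) (snd (inv p k))))\<^sup>2)
      \<le> (norm T * norm X)\<^sup>2" (is "(\<Sum>k\<in>F. ?f (inv p k)) \<le> _") if "finite F" for F X
  proof -
    define A where "A = fst ` inv p ` F"
    define B where "B = snd ` inv p ` F"
    have fin: "finite A" "finite B" using that by (auto simp: A_def B_def)
    have "inj_on (inv p) F"
      using assms by (meson bij_betw_def bij_imp_bij_inv inj_on_subset subset_UNIV)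
    then have "(\<Sum>k\<in>F. ?f (inv p k)) = (\<Sum>q\<in>inv p ` F. ?f q)"
      by (simp add: sum.reindex)
    also have "\<dots> \<le> (\<Sum>q\<in>A \<times> B. ?f q)"
      using fin subset_fst_snd[of "inv p ` F"] by (intro sum_mono2) (auto simp: A_def B_def)
    also have "\<dots> = (\<Sum>a\<in>A. \<Sum>b\<in>B. ?f (a, b))"
      by (simp add: sum.cartesian_product case_prod_unfold)
    also have "\<dots> \<le> (\<Sum>a\<in>A. (norm T)\<^sup>2 * (norm (row X a))\<^sup>2)"
    proof (rule sum_mono)
      fix a
      have "L2_set (\<lambda>b. cmod (ell2_coeff (bop_apply T (row X a)) b)) B \<le> norm (bop_apply T (row X a))"
        using fin by (intro L2_set_le_norm_ell2)
      also have "\<dots> \<le> norm T * norm (row X a)"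
        by (rule norm_bop_apply)
      finally have "(\<Sum>b\<in>B. (cmod (ell2_coeff (bop_apply T (row X a)) b))\<^sup>2) \<le> (norm T * norm (row X a))\<^sup>2"
        unfolding L2_set_def by (rule sqrt_le_D)
      then show "(\<Sum>b\<in>B. ?f (a, b)) \<le> (norm T)\<^sup>2 * (norm (row X a))\<^sup>2"
        by (simp add: power_mult_distrib)
    qed
    also have "\<dots> = (norm T)\<^sup>2 * (\<Sum>a\<in>A. (norm (row X a))\<^sup>2)"
      by (simp add: sum_distrib_left)
    also have "(\<Sum>a\<in>A. (norm (row X a))\<^sup>2) = (\<Sum>a\<in>A. \<Sum>\<^sub>\<infinity>b. (cmod (ell2_coeff (row X a) b))\<^sup>2)"
      by (simp add: norm_ell2.rep_eq infsum_nonneg)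
    also have "(norm T)\<^sup>2 * \<dots> \<le> (norm T)\<^sup>2 * (norm X)\<^sup>2"
    proof (rule mult_left_mono)
      have hs: "((\<lambda>b. \<Sum>a\<in>A. (cmod (ell2_coeff (row X a) b))\<^sup>2) has_sum
          (\<Sum>a\<in>A. \<Sum>\<^sub>\<infinity>b. (cmod (ell2_coeff (row X a) b))\<^sup>2)) UNIV"
        using fin(1) by (induction A) (auto intro!: has_sum_add has_sum_infsum ell2_coeff_summable)
      show "(\<Sum>a\<in>A. \<Sum>\<^sub>\<infinity>b. (cmod (ell2_coeff (row X a) b))\<^sup>2) \<le> (norm X)\<^sup>2"
      proof (rule has_sum_le_finite_sums[OF hs])
        fix G :: "'b set" assume G: "finite G"
        have inj_p: "inj_on p (A \<times> G)"
          using assms by (meson bij_def inj_on_subset subset_UNIV)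
        have "(\<Sum>b\<in>G. \<Sum>a\<in>A. (cmod (ell2_coeff (row X a) b))\<^sup>2)
            = (\<Sum>q\<in>A \<times> G. (cmod (ell2_coeff X (p q)))\<^sup>2)"
          by (subst sum.swap) (simp add: sum.cartesian_product case_prod_unfold row)
        also have "\<dots> = (\<Sum>k\<in>p ` (A \<times> G). (cmod (ell2_coeff X k))\<^sup>2)"
          by (simp add: sum.reindex[OF inj_p])
        also have "\<dots> \<le> (norm X)\<^sup>2"
          using L2_set_le_norm_ell2[of "p ` (A \<times> G)" X] fin G
          unfolding L2_set_def by (intro sqrt_le_D) simp
        finally show "(\<Sum>b\<in>G. \<Sum>a\<in>A. (cmod (ell2_coeff (row X a) b))\<^sup>2) \<le> (norm X)\<^sup>2" .
      qed
    qed simp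
    finally show ?thesis by (simp add: power_mult_distrib)
  qed
  then have L2: "L2_set (\<lambda>k. cmod (ell2_coeff (bop_apply T (row X (fst (inv p k)))) (snd (inv p k)))) F
      \<le> norm T * norm X" if "finite F" for F X
    unfolding L2_set_def using that by (intro real_le_lsqrt) (auto intro!: sum_nonneg)
  have "\<exists>Y. ell2_coeff Y = (\<lambda>k. ell2_coeff (bop_apply T (row X (fst (inv p k)))) (snd (inv p k)))
      \<and> norm Y \<le> norm T * norm X" for X
    by (rule ell2_exists[OF L2[where X = X]]) auto
  then obtain h where h: "\<And>X. ell2_coeff (h X) =
      (\<lambda>k. ell2_coeff (bop_apply T (row X (fst (inv p k)))) (snd (inv p k)))"
    and h_norm: "\<And>X. norm (h X) \<le> norm T * norm X"
    by metis
  have row_add: "row (X + Y) a = row X a + row Y a" and row_scale: "row (c *\<^sub>C X) a = c *\<^sub>C row X a"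
    for X Y a c
    by (auto intro!: ell2_eqI simp: row)
  have "\<exists>A. \<forall>X. bop_apply A X = h X"
    by (rule bop_exists[OF _ _ h_norm])
      (auto intro!: ell2_eqI simp: h row_add row_scale bop_linear)
  then obtain A where A: "\<And>X. bop_apply A X = h X" by blast
  have "ell2_coeff (bop_apply A X) (p (a, b)) = ell2_coeff (bop_apply T x) b"
    if "\<forall>b. ell2_coeff x b = ell2_coeff X (p (a, b))" for X x a b
  proof -
    have "x = row X a"
      using that by (intro ell2_eqI) (simp add: row)
    then show ?thesis
      using assms by (simp add: A h bij_is_inj)
  qed
  moreover have "norm A \<le> norm T"
    by (rule norm_bop_bound) (simp_all add: A h_norm)
  ultimately show ?thesis by blast
qed

definition tensor_op :: "'i ell2 bop \<Rightarrow> 'j ell2 bop \<Rightarrow> ('i \<times> 'j) ell2 bop" where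
  "tensor_op S T = (THE R. \<forall>x y. bop_apply R (tensor_vec x y) = tensor_vec (bop_apply S x) (bop_apply T y))"

lemma tensor_op_unique:
  fixes R R' :: "('i \<times> 'j) ell2 bop"
  assumes "\<And>x y. bop_apply R (tensor_vec x y) = bop_apply R' (tensor_vec x y)"
  shows "R = R'"
proof (rule bop_eqI)
  fix X
  have basis: "ell2_basis (i, j) = tensor_vec (ell2_basis i) (ell2_basis j)" for i :: 'i and j :: 'j
    by (rule ell2_eqI) (auto simp: ell2_basis.rep_eq tensor_vec.rep_eq split: prod.splits)
  have eq: "bop_apply (star R) Z = bop_apply (star R') Z" for Z
  proof (rule ell2_eqI)
    fix q :: "'i \<times> 'j"
    obtain i j where q: "q = (i, j)" by fastforce
    have "cinner (bop_apply (star R) Z) (ell2_basis q) = cinner (bop_apply (star R') Z) (ell2_basis q)"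
      by (simp only: star_bop q basis assms)
    then show "ell2_coeff (bop_apply (star R) Z) q = ell2_coeff (bop_apply (star R') Z) q"
      by (simp add: cinner_ell2_basis)
  qed
  show "bop_apply R X = bop_apply R' X"
  proof (rule cinner_ext)
    fix Z
    show "cinner (bop_apply R X) Z = cinner (bop_apply R' X) Z"
      by (simp only: eq flip: star_bop_right)
  qed
qed

lemma tensor_op_exists:
  "\<exists>R. norm R \<le> norm S * norm T \<and> (\<forall>x y. bop_apply R (tensor_vec x y) = tensor_vec (bop_apply S x) (bop_apply T y))"
proof -
  obtain A :: "('a \<times> 'b) ell2 bop" where A_norm: "norm A \<le> norm T" and A: "\<forall>X x i j. (\<forall>j. ell2_coeff x j = ell2_coeff X (i, j)) \<longrightarrow>
      ell2_coeff (bop_apply A X) (i, j) = ell2_coeff (bop_apply T x) j"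
    using amplification_exists[OF bij_id, of T] unfolding id_apply by (elim exE conjE)
  have "bij (\<lambda>(j :: 'b, i :: 'a). (i, j))"
    by (rule bij_betw_byWitness[where f' = "\<lambda>(i, j). (j, i)"]) auto
  from amplification_exists[OF this, of S]
  obtain B :: "('a \<times> 'b) ell2 bop" where B_norm: "norm B \<le> norm S" and B: "\<forall>X x j i. (\<forall>i. ell2_coeff x i = ell2_coeff X (i, j)) \<longrightarrow>
      ell2_coeff (bop_apply B X) (i, j) = ell2_coeff (bop_apply S x) i"
    unfolding prod.case by (elim exE conjE)
  have "bop_apply (A * B) (tensor_vec x y) = tensor_vec (bop_apply S x) (bop_apply T y)" for x y
  proof -
    have 1: "bop_apply B (tensor_vec x y) = tensor_vec (bop_apply S x) y"
    proof (rule ell2_eqI)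
      fix q :: "'a \<times> 'b"
      obtain i j where q: "q = (i, j)" by fastforce
      show "ell2_coeff (bop_apply B (tensor_vec x y)) q = ell2_coeff (tensor_vec (bop_apply S x) y) q"
        unfolding q ell2_coeff_tensor_vec
        by (subst B[rule_format, where x = "ell2_coeff y j *\<^sub>C x"]) (auto simp: ell2_coeff_tensor_vec bop_linear)
    qed
    have 2: "bop_apply A (tensor_vec z y) = tensor_vec z (bop_apply T y)" for z
    proof (rule ell2_eqI)
      fix q :: "'a \<times> 'b"
      obtain i j where q: "q = (i, j)" by fastforce
      show "ell2_coeff (bop_apply A (tensor_vec z y)) q = ell2_coeff (tensor_vec z (bop_apply T y)) q"
        unfolding q ell2_coeff_tensor_vec
        by (subst A[rule_format, where x = "ell2_coeff z i *\<^sub>C y"]) (auto simp: ell2_coeff_tensor_vec bop_linear)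
    qed
    show ?thesis by (simp add: bop_apply_mult 1 2)
  qed
  moreover have "norm (A * B) \<le> norm S * norm T"
    using norm_mult_ineq[of A B] mult_mono[OF A_norm B_norm] by (simp add: mult.commute)
  ultimately show ?thesis by blast
qed

lemma tensor_op_apply:
  "bop_apply (tensor_op S T) (tensor_vec x y) = tensor_vec (bop_apply S x) (bop_apply T y)"
  and norm_tensor_op_le: "norm (tensor_op S T) \<le> norm S * norm T"
proof -
  obtain R where le: "norm R \<le> norm S * norm T"
    and R: "\<forall>x y. bop_apply R (tensor_vec x y) = tensor_vec (bop_apply S x) (bop_apply T y)"
    using tensor_op_exists[of S T] by (elim exE conjE)
  have "tensor_op S T = R"
    unfolding tensor_op_def
  proof (rule the_equality, rule R)
    fix R'
    assume R': "\<forall>x y. bop_apply R' (tensor_vec x y) = tensor_vec (bop_apply S x) (bop_apply T y)"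
    show "R' = R"
      by (rule tensor_op_unique) (simp only: R[rule_format] R'[rule_format])
  qed
  with R le show "bop_apply (tensor_op S T) (tensor_vec x y) = tensor_vec (bop_apply S x) (bop_apply T y)"
    and "norm (tensor_op S T) \<le> norm S * norm T" by simp_all
qed


section \<open>Bounded functions with values in a C*-algebra\<close>

lemma bounded_linear_scaleC: "bounded_linear (\<lambda>x::'a::complex_normed_vector. c *\<^sub>C x)"
  by (rule bounded_linear_intro[where K = "cmod c"])
    (auto simp: scaleC_add_right norm_scaleC scaleC_scaleR mult.commute)

lemma norm_star [simp]: "norm (star x) = norm (x :: 'a::cstar_algebra)"
proof -
  have le: "norm x \<le> norm (star x)" for x :: 'a
  proof (cases "x = 0")
    case False
    have "norm x * norm x \<le> norm (star x) * norm x"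
      using norm_mult_ineq[of "star x" x] by (simp add: cstar_identity power2_eq_square)
    with False show ?thesis by simp
  qed auto
  from le[of x] le[of "star x"] show ?thesis by (simp add: star_star)
qed

lemma bounded_linear_star: "bounded_linear (star :: 'a \<Rightarrow> 'a::cstar_algebra)"
proof (rule bounded_linear_intro[where K = 1])
  show "star (r *\<^sub>R x) = r *\<^sub>R star x" for r and x :: 'a
    using star_scaleC[of "complex_of_real r" x] by (simp only: scaleC_of_real complex_cnj_complex_of_real)
qed (auto simp: star_add)

setup_lifting type_definition_bcontfun

lemma bcontfun_bounded_linear:
  fixes g :: "'b \<Rightarrow> 'b::real_normed_vector"
  assumes "f \<in> bcontfun" "bounded_linear g"
  shows "(\<lambda>x. g (f x)) \<in> bcontfun"
proof -
  have "bounded (g ` range f)"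
    using assms by (intro bounded_linear_image) (auto simp: bcontfun_def)
  moreover have "continuous_on UNIV (\<lambda>x. g (f x))"
    by (rule bounded_linear.continuous_on[OF assms(2)]) (use assms(1) in \<open>simp add: bcontfun_def\<close>)
  ultimately show ?thesis
    by (simp add: bcontfun_def image_image)
qed

instantiation bcontfun :: (metric_space, complex_normed_vector) complex_normed_vector
begin

lift_definition scaleC_bcontfun :: "complex \<Rightarrow> ('a \<Rightarrow>\<^sub>C 'b) \<Rightarrow> 'a \<Rightarrow>\<^sub>C 'b" is
  "\<lambda>c f x. c *\<^sub>C f x"
  by (rule bcontfun_bounded_linear[OF _ bounded_linear_scaleC])

lemma apply_bcontfun_scaleC [simp]: "apply_bcontfun (c *\<^sub>C f) x = c *\<^sub>C apply_bcontfun f x"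
  by transfer (rule refl)

instance
proof
  fix f g :: "'a \<Rightarrow>\<^sub>C 'b" and r :: real and c d :: complex
  show "c *\<^sub>C (f + g) = c *\<^sub>C f + c *\<^sub>C g" "(c + d) *\<^sub>C f = c *\<^sub>C f + d *\<^sub>C f"
    "c *\<^sub>C d *\<^sub>C f = (c * d) *\<^sub>C f" "complex_of_real r *\<^sub>C f = r *\<^sub>R f"
    by (auto intro!: bcontfun_eqI simp: scaleC_add_right scaleC_add_left scaleC_scaleC scaleC_of_real)
  have le: "norm (c *\<^sub>C f) \<le> cmod c * norm f" for c and f :: "'a \<Rightarrow>\<^sub>C 'b"
    by (rule norm_bound) (auto simp: norm_scaleC intro!: mult_left_mono norm_bounded)
  show "norm (c *\<^sub>C f) = cmod c * norm f"
  proof (rule antisym[OF le])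
    show "cmod c * norm f \<le> norm (c *\<^sub>C f)"
    proof (cases "c = 0")
      case False
      have "f = inverse c *\<^sub>C c *\<^sub>C f"
        using False by (auto intro!: bcontfun_eqI simp: scaleC_scaleC)
      then have "norm f \<le> cmod (inverse c) * norm (c *\<^sub>C f)"
        using le[of "inverse c" "c *\<^sub>C f"] by simp
      then show ?thesis
        using False by (simp add: norm_inverse norm_divide field_simps)
    qed auto
  qed
qed

end

instantiation bcontfun :: (metric_space, cstar_algebra) cstar_algebra
begin

lift_definition one_bcontfun :: "'a \<Rightarrow>\<^sub>C 'b" is "\<lambda>_. 1"
  by (rule const_bcontfun)
lift_definition times_bcontfun :: "('a \<Rightarrow>\<^sub>C 'b) \<Rightarrow> ('a \<Rightarrow>\<^sub>C 'b) \<Rightarrow> 'a \<Rightarrow>\<^sub>C 'b" is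
  "\<lambda>f g x. f x * g x"
proof -
  fix f g :: "'a \<Rightarrow> 'b"
  assume f: "f \<in> bcontfun" and g: "g \<in> bcontfun"
  obtain K L where K: "\<And>x. norm (f x) \<le> K" and L: "\<And>x. norm (g x) \<le> L"
    using f g unfolding bcontfun_def bounded_iff by auto
  have "norm (f x * g x) \<le> K * L" for x
    by (rule order_trans[OF norm_mult_ineq mult_mono[OF K L order_trans[OF norm_ge_zero K] norm_ge_zero]])
  then show "(\<lambda>x. f x * g x) \<in> bcontfun"
    using f g by (intro bcontfun_normI continuous_on_mult) (auto simp: bcontfun_def)
qed
lift_definition star_bcontfun :: "('a \<Rightarrow>\<^sub>C 'b) \<Rightarrow> 'a \<Rightarrow>\<^sub>C 'b" is "\<lambda>f x. star (f x)"
  by (rule bcontfun_bounded_linear[OF _ bounded_linear_star])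

lemma apply_bcontfun_one [simp]: "apply_bcontfun 1 x = 1"
  by transfer (rule refl)
lemma apply_bcontfun_mult [simp]: "apply_bcontfun (f * g) x = apply_bcontfun f x * apply_bcontfun g x"
  by transfer (rule refl)
lemma apply_bcontfun_star [simp]: "apply_bcontfun (star f) x = star (apply_bcontfun f x)"
  by transfer (rule refl)

instance
proof
  fix f g h :: "'a \<Rightarrow>\<^sub>C 'b" and r :: real and c :: complex
  show "f * g * h = f * (g * h)" "1 * f = f" "f * 1 = f"
    "(f + g) * h = f * h + g * h" "f * (g + h) = f * g + f * h"
    "(r *\<^sub>R f) * g = r *\<^sub>R (f * g)" "f * (r *\<^sub>R g) = r *\<^sub>R (f * g)"
    "(c *\<^sub>C f) * g = c *\<^sub>C (f * g)" "f * (c *\<^sub>C g) = c *\<^sub>C (f * g)"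
    "star (star f) = f" "star (f + g) = star f + star g" "star (c *\<^sub>C f) = cnj c *\<^sub>C star f"
    "star (f * g) = star g * star f"
    by (auto intro!: bcontfun_eqI simp: algebra_simps mult_scaleC_left mult_scaleC_right
        star_star star_add star_scaleC star_mult)
  show norm1: "norm (1 :: 'a \<Rightarrow>\<^sub>C 'b) = 1"
    using norm_bounded[of "1 :: 'a \<Rightarrow>\<^sub>C 'b" undefined] norm_bound[of "1 :: 'a \<Rightarrow>\<^sub>C 'b" 1]
    by simp
  show "(0 :: 'a \<Rightarrow>\<^sub>C 'b) \<noteq> 1"
    using norm1 by (metis norm_zero zero_neq_one)
  show mult: "norm (f * g) \<le> norm f * norm g" for f g :: "'a \<Rightarrow>\<^sub>C 'b"
    by (rule norm_bound)
      (simp, rule order_trans[OF norm_mult_ineq mult_mono[OF norm_bounded norm_bounded norm_ge_zero norm_ge_zero]])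
  have star_le: "norm (star f) \<le> norm f"
    by (rule norm_bound) (simp add: norm_bounded)
  show "norm (star f * f) = (norm f)\<^sup>2"
  proof (rule antisym)
    show "norm (star f * f) \<le> (norm f)\<^sup>2"
      using mult[of "star f" f] mult_right_mono[OF star_le, of "norm f"]
      by (simp add: power2_eq_square)
    have "norm f \<le> sqrt (norm (star f * f))"
    proof (rule norm_bound)
      fix x
      have "(norm (apply_bcontfun f x))\<^sup>2 = norm (apply_bcontfun (star f * f) x)"
        by (simp add: cstar_identity)
      also have "\<dots> \<le> norm (star f * f)"
        by (rule norm_bounded)
      finally show "norm (apply_bcontfun f x) \<le> sqrt (norm (star f * f))"
        by (rule real_le_rsqrt)
    qed
    then show "(norm f)\<^sup>2 \<le> norm (star f * f)"
      by (metis norm_ge_zero real_sqrt_le_iff real_sqrt_unique)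
  qed
qed

end


section \<open>Subalgebras, homomorphisms, states, GNS representations\<close>

definition unital_subalgebra :: "'a::cstar_algebra set \<Rightarrow> bool" where
  "unital_subalgebra M \<longleftrightarrow> 1 \<in> M \<and>
    (\<forall>x\<in>M. \<forall>y\<in>M. x + y \<in> M \<and> x * y \<in> M) \<and> (\<forall>c. \<forall>x\<in>M. c *\<^sub>C x \<in> M)"

definition star_subalgebra :: "'a::cstar_algebra set \<Rightarrow> bool" where
  "star_subalgebra M \<longleftrightarrow> unital_subalgebra M \<and> (\<forall>x\<in>M. star x \<in> M)"

definition clinear_on :: "'a::complex_vector set \<Rightarrow> ('a \<Rightarrow> 'b::complex_vector) \<Rightarrow> bool" where
  "clinear_on A f \<longleftrightarrow>
    (\<forall>x\<in>A. \<forall>y\<in>A. f (x + y) = f x + f y) \<and> (\<forall>c. \<forall>x\<in>A. f (c *\<^sub>C x) = c *\<^sub>C f x)"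

definition star_hom_on :: "'a::cstar_algebra set \<Rightarrow> ('a \<Rightarrow> 'b::cstar_algebra) \<Rightarrow> bool" where
  "star_hom_on A f \<longleftrightarrow> clinear_on A f \<and> f 1 = 1 \<and>
    (\<forall>x\<in>A. \<forall>y\<in>A. f (x * y) = f x * f y) \<and> (\<forall>x\<in>A. f (star x) = star (f x))"

text \<open>States are positive functionals of norm one; the norm is attained at the unit.\<close>

definition state_on :: "'a::cstar_algebra set \<Rightarrow> ('a \<Rightarrow> complex) \<Rightarrow> bool" where
  "state_on A h \<longleftrightarrow> clinear_on A h \<and> (\<forall>a\<in>A. h (star a * a) \<in> \<real>\<^sub>\<ge>\<^sub>0) \<and>
    (\<forall>a\<in>A. cmod (h a) \<le> norm a) \<and> h 1 = 1"

text \<open>For normed spaces, the sort \<^class>\<open>perfect_space\<close> means that the space is not zero.\<close>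

definition gns_representation ::
  "'a::cstar_algebra set \<Rightarrow> ('a \<Rightarrow> complex) \<Rightarrow> ('a \<Rightarrow> 'h::{chilbert_space, perfect_space} bop) \<Rightarrow> 'h \<Rightarrow> bool"
  where
  "gns_representation A h \<pi> \<xi> \<longleftrightarrow> star_hom_on A \<pi> \<and>
    (\<forall>a\<in>A. cinner \<xi> (bop_apply (\<pi> a) \<xi>) = h a) \<and>
    closure ((\<lambda>a. bop_apply (\<pi> a) \<xi>) ` A) = UNIV"


section \<open>The free unitary quantum group\<close>

definition adjoint_matrix :: "'a::cstar_algebra^'n^'n \<Rightarrow> 'a^'n^'n" where
  "adjoint_matrix V = (\<chi> r s. star (V $ s $ r))"

definition conj_matrix :: "'a::cstar_algebra^'n^'n \<Rightarrow> 'a^'n^'n" where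
  "conj_matrix V = (\<chi> r s. star (V $ r $ s))"

definition unitary_matrix :: "'a::cstar_algebra^'n^'n \<Rightarrow> bool" where
  "unitary_matrix V \<longleftrightarrow> V ** adjoint_matrix V = mat 1 \<and> adjoint_matrix V ** V = mat 1"

text \<open>
  The points of the following type are the representations on \<open>\<ell>\<^sup>2(\<nat>)\<close> of the relations that define
  the universal C*-algebra. A C*-algebra generated by finitely many elements is separable, hence embeds
  unitally in the bounded operators on \<open>\<ell>\<^sup>2(\<nat>)\<close>. Therefore the universal C*-norm of a *-polynomial in
  the generators is the supremum of its norms over these points, and the universal C*-algebra is
  the C*-algebra generated by the coordinate functions among the bounded operator-valued functions
  on this type. The discrete metric makes every function on the type continuous.
\<close>

typedef 'n::finite biunitary =
  "{V :: nat ell2 bop^'n^'n. unitary_matrix V \<and> unitary_matrix (conj_matrix V)}"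
  morphisms biunitary_matrix Abs_biunitary
proof -
  have star1: "star (1 :: nat ell2 bop) = 1"
    by (rule star_bop_eqI) simp
  have star0: "star (0 :: nat ell2 bop) = 0"
    by (rule star_bop_eqI) (simp add: zero_bop.rep_eq bop_apply_def)
  have "adjoint_matrix (mat 1) = (mat 1 :: nat ell2 bop^'n^'n)"
    "conj_matrix (mat 1) = (mat 1 :: nat ell2 bop^'n^'n)"
    by (auto simp: adjoint_matrix_def conj_matrix_def mat_def vec_eq_iff star1 star0)
  then show ?thesis
    by (intro exI[of _ "mat 1"]) (simp add: unitary_matrix_def)
qed

instantiation biunitary :: (finite) metric_space
begin

definition dist_biunitary :: "'a biunitary \<Rightarrow> 'a biunitary \<Rightarrow> real" where
  "dist_biunitary V W = (if V = W then 0 else 1)"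
definition uniformity_biunitary :: "('a biunitary \<times> 'a biunitary) filter" where
  "uniformity_biunitary = (INF e\<in>{0 <..}. principal {(V, W). dist V W < e})"
definition open_biunitary :: "'a biunitary set \<Rightarrow> bool" where
  "open_biunitary S = (\<forall>V\<in>S. \<forall>\<^sub>F (V', W) in uniformity. V' = V \<longrightarrow> W \<in> S)"

instance
  by standard (auto simp: dist_biunitary_def uniformity_biunitary_def open_biunitary_def)

end

lemma continuous_on_biunitary: "continuous_on S (f :: 'n::finite biunitary \<Rightarrow> 'b::metric_space)"
  unfolding continuous_on_iff
  by (auto intro!: exI[of _ "1/2"] simp: dist_biunitary_def split: if_splits)

lemma continuous_on_biunitary_prod:
  "continuous_on S (f :: 'n::finite biunitary \<times> 'm::finite biunitary \<Rightarrow> 'b::metric_space)"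
  unfolding continuous_on_iff
proof (intro ballI allI impI exI[of _ "1/2"] conjI)
  fix p q :: "'n biunitary \<times> 'm biunitary" and e :: real
  assume "dist q p < 1 / 2" "0 < e"
  moreover have "dist (fst q) (fst p) \<le> dist q p" "dist (snd q) (snd p) \<le> dist q p"
    by (rule dist_fst_le, rule dist_snd_le)
  ultimately have "fst q = fst p" "snd q = snd p"
    by (auto simp: dist_biunitary_def split: if_splits)
  then have "q = p" by (simp add: prod_eq_iff)
  with \<open>0 < e\<close> show "dist (f q) (f p) < e" by simp
qed simp

type_synonym 'n rep_fun = "'n biunitary \<Rightarrow>\<^sub>C nat ell2 bop"
type_synonym 'n rep_fun2 = "('n biunitary \<times> 'n biunitary) \<Rightarrow>\<^sub>C (nat \<times> nat) ell2 bop"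

definition generator :: "'n \<Rightarrow> 'n \<Rightarrow> 'n::finite rep_fun" where
  "generator r s = Bcontfun (\<lambda>V. biunitary_matrix V $ r $ s)"

lemma norm_biunitary_entry: "norm (biunitary_matrix (V :: 'n::finite biunitary) $ r $ s) \<le> 1"
proof (rule norm_bop_bound)
  fix x
  define v where "v = biunitary_matrix V"
  have "adjoint_matrix v ** v = mat 1"
    using biunitary_matrix[of V] by (simp add: v_def unitary_matrix_def)
  then have "(adjoint_matrix v ** v) $ s $ s = mat 1 $ s $ s" by simp
  then have "(\<Sum>k\<in>UNIV. star (v $ k $ s) * v $ k $ s) = 1"
    by (simp add: matrix_matrix_mult_def adjoint_matrix_def mat_def)
  then have "cinner (bop_apply (\<Sum>k\<in>UNIV. star (v $ k $ s) * v $ k $ s) x) x = cinner x x"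
    by simp
  moreover have "cinner (bop_apply (\<Sum>k\<in>K. star (v $ k $ s) * v $ k $ s) x) x
      = of_real (\<Sum>k\<in>K. (norm (bop_apply (v $ k $ s) x))\<^sup>2)" if "finite K" for K
    using that
  proof (induction K)
    case empty
    then show ?case by (simp add: bop_apply_def zero_bop.rep_eq)
  next
    case (insert k K)
    then show ?case
      by (simp add: bop_apply_add cinner_add_left bop_apply_mult star_bop cinner_self)
  qed
  ultimately have "complex_of_real (\<Sum>k\<in>UNIV. (norm (bop_apply (v $ k $ s) x))\<^sup>2) = of_real ((norm x)\<^sup>2)"
    by (simp add: cinner_self)
  then have "(\<Sum>k\<in>UNIV. (norm (bop_apply (v $ k $ s) x))\<^sup>2) = (norm x)\<^sup>2"
    using of_real_eq_iff by blast
  moreover have "(norm (bop_apply (v $ r $ s) x))\<^sup>2 \<le> (\<Sum>k\<in>UNIV. (norm (bop_apply (v $ k $ s) x))\<^sup>2)"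
    by (rule member_le_sum[of r UNIV "\<lambda>k. (norm (bop_apply (v $ k $ s) x))\<^sup>2"]) auto
  ultimately have "(norm (bop_apply (v $ r $ s) x))\<^sup>2 \<le> (norm x)\<^sup>2" by simp
  then show "norm (bop_apply (biunitary_matrix V $ r $ s) x) \<le> 1 * norm x"
    unfolding v_def[symmetric] mult_1_left by (rule power2_le_imp_le) simp
qed simp

lemma generator_apply: "apply_bcontfun (generator r s) V = biunitary_matrix V $ r $ s"
  unfolding generator_def
  by (subst Bcontfun_inverse)
    (auto intro!: bcontfun_normI continuous_on_biunitary norm_biunitary_entry)

definition A_u :: "'n::finite rep_fun set" where
  "A_u = closure (star_subalgebra hull {generator r s | r s. True})"

lemma A_u_generators:
  "unitary_matrix (\<chi> r s. (generator r s :: 'n::finite rep_fun))"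
  "unitary_matrix (conj_matrix (\<chi> r s. (generator r s :: 'n rep_fun)))"
  "generator r s \<in> (A_u :: 'n rep_fun set)"
proof -
  have sum: "apply_bcontfun (\<Sum>k\<in>K. f k) V = (\<Sum>k\<in>K. apply_bcontfun (f k) V)"
    if "finite K" for K :: "'n set" and f :: "'n \<Rightarrow> 'n rep_fun" and V
    using that by (induction K) auto
  have ent: "(V ** W) $ i $ j = (\<Sum>k\<in>UNIV. V $ i $ k * W $ k $ j)"
    for V W :: "'a::cstar_algebra^'n^'n" and i j
    by (simp add: matrix_matrix_mult_def)
  have id: "apply_bcontfun (if i = j then 1 else 0) V = (if i = j then 1 else 0)"
    for i j :: 'n and V :: "'n biunitary"
    by simp
  have rel: "unitary_matrix (biunitary_matrix V)" "unitary_matrix (conj_matrix (biunitary_matrix V))"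
    for V :: "'n biunitary"
    using biunitary_matrix[of V] by auto
  show "unitary_matrix (\<chi> r s. (generator r s :: 'n rep_fun))"
    unfolding unitary_matrix_def vec_eq_iff ent mat_def
    using rel(1) unfolding unitary_matrix_def vec_eq_iff ent mat_def
    by (auto intro!: bcontfun_eqI simp: sum id adjoint_matrix_def generator_apply)
  show "unitary_matrix (conj_matrix (\<chi> r s. (generator r s :: 'n rep_fun)))"
    unfolding unitary_matrix_def vec_eq_iff ent mat_def
    using rel(2) unfolding unitary_matrix_def vec_eq_iff ent mat_def
    by (auto intro!: bcontfun_eqI simp: sum id adjoint_matrix_def conj_matrix_def generator_apply)
  show "generator r s \<in> (A_u :: 'n rep_fun set)"
    unfolding A_u_def by (rule closure_subset[THEN subsetD], rule hull_inc) auto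
qed

lemma A_u_universal:
  fixes V :: "nat ell2 bop^'n::finite^'n"
  assumes "unitary_matrix V" "unitary_matrix (conj_matrix V)"
  shows "\<exists>\<phi>. star_hom_on A_u \<phi> \<and> (\<forall>r s. \<phi> (generator r s) = V $ r $ s)"
  using assms
  by (intro exI[of _ "\<lambda>a. apply_bcontfun a (Abs_biunitary V)"])
    (auto simp: star_hom_on_def clinear_on_def generator_apply Abs_biunitary_inverse)

text \<open>
  The spatial tensor product of \<^term>\<open>A_u\<close> with itself acts on the direct sum of the spaces
  \<open>\<ell>\<^sup>2(\<nat>) \<otimes> \<ell>\<^sup>2(\<nat>) = \<ell>\<^sup>2(\<nat> \<times> \<nat>)\<close> over all pairs of points.
\<close>

definition tensor_fun ::
  "'n::finite rep_fun \<Rightarrow> 'n rep_fun \<Rightarrow> 'n rep_fun2" (infixr "\<otimes>\<^sub>f" 70) where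
  "a \<otimes>\<^sub>f b = Bcontfun (\<lambda>(V, W). tensor_op (apply_bcontfun a V) (apply_bcontfun b W))"

lemma tensor_fun_apply:
  "apply_bcontfun (a \<otimes>\<^sub>f b) (V, W) = tensor_op (apply_bcontfun a V) (apply_bcontfun b W)"
proof -
  have "norm (tensor_op (apply_bcontfun a V) (apply_bcontfun b W)) \<le> norm a * norm b" for V W
    by (rule order_trans[OF norm_tensor_op_le]) (intro mult_mono norm_bounded norm_ge_zero)
  then have "(\<lambda>(V, W). tensor_op (apply_bcontfun a V) (apply_bcontfun b W)) \<in> bcontfun"
    by (intro bcontfun_normI[where b = "norm a * norm b"] continuous_on_biunitary_prod) auto
  then show ?thesis
    by (simp add: tensor_fun_def Bcontfun_inverse)
qed

definition A_u_tensor :: "'n::finite rep_fun2 set" where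
  "A_u_tensor = closure (complex_vector.span {a \<otimes>\<^sub>f b | a b. a \<in> A_u \<and> b \<in> A_u})"

definition coproduct :: "('n::finite rep_fun \<Rightarrow> 'n rep_fun2) \<Rightarrow> bool" where
  "coproduct \<Delta> \<longleftrightarrow> star_hom_on A_u \<Delta> \<and> \<Delta> ` A_u \<subseteq> A_u_tensor \<and>
    (\<forall>r s. \<Delta> (generator r s) = (\<Sum>k\<in>UNIV. generator r k \<otimes>\<^sub>f generator k s))"

text \<open>
  The slice maps \<open>h \<otimes> id\<close> and \<open>id \<otimes> h\<close> are the bounded linear extensions of
  \<open>a \<otimes> b \<mapsto> h(a) b\<close> and \<open>a \<otimes> b \<mapsto> h(b) a\<close> to \<^term>\<open>A_u_tensor\<close>.
\<close>

definition left_slice ::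
  "('n::finite rep_fun \<Rightarrow> complex) \<Rightarrow> ('n rep_fun2 \<Rightarrow> 'n rep_fun) \<Rightarrow> bool" where
  "left_slice h L \<longleftrightarrow> clinear_on A_u_tensor L \<and> (\<exists>K. \<forall>x\<in>A_u_tensor. norm (L x) \<le> K * norm x) \<and>
    (\<forall>a\<in>A_u. \<forall>b\<in>A_u. L (a \<otimes>\<^sub>f b) = h a *\<^sub>C b)"

definition right_slice ::
  "('n::finite rep_fun \<Rightarrow> complex) \<Rightarrow> ('n rep_fun2 \<Rightarrow> 'n rep_fun) \<Rightarrow> bool" where
  "right_slice h R \<longleftrightarrow> clinear_on A_u_tensor R \<and> (\<exists>K. \<forall>x\<in>A_u_tensor. norm (R x) \<le> K * norm x) \<and>
    (\<forall>a\<in>A_u. \<forall>b\<in>A_u. R (a \<otimes>\<^sub>f b) = h b *\<^sub>C a)"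

definition haar_state ::
  "('n::finite rep_fun \<Rightarrow> 'n rep_fun2) \<Rightarrow> ('n rep_fun \<Rightarrow> complex) \<Rightarrow> bool" where
  "haar_state \<Delta> h \<longleftrightarrow> state_on A_u h \<and>
    (\<exists>L R. left_slice h L \<and> right_slice h R \<and> (\<forall>a\<in>A_u. L (\<Delta> a) = h a *\<^sub>C 1 \<and> R (\<Delta> a) = h a *\<^sub>C 1))"

text \<open>
  For a GNS representation \<open>\<pi>\<close> of the Haar state, \<open>C(U\<^sub>n\<^sup>+)\<close> is the image of \<open>\<pi>\<close> and its norm is the
  operator norm. The following is the norm closure of the unital algebra generated by the images of
  the generators, without their adjoints.
\<close>

definition nonselfadjoint_algebra ::
  "('n::finite rep_fun \<Rightarrow> 'h::{chilbert_space, perfect_space} bop) \<Rightarrow> 'h bop set" where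
  "nonselfadjoint_algebra \<pi> = closure (unital_subalgebra hull {\<pi> (generator r s) | r s. True})"


section \<open>The metric approximation property\<close>

definition finite_rank_contraction_on :: "'a::complex_normed_vector set \<Rightarrow> ('a \<Rightarrow> 'a) \<Rightarrow> bool" where
  "finite_rank_contraction_on Y S \<longleftrightarrow> S ` Y \<subseteq> Y \<and> clinear_on Y S \<and>
    (\<forall>y\<in>Y. norm (S y) \<le> norm y) \<and> (\<exists>B. finite B \<and> S ` Y \<subseteq> complex_vector.span B)"

text \<open>
  The net is rendered by the filter that it generates on the set of maps; conversely every proper
  filter is the filter of some net.
\<close>

definition metric_approximation_property :: "'a::complex_normed_vector set \<Rightarrow> bool" where
  "metric_approximation_property Y \<longleftrightarrow>
    (\<exists>F. F \<noteq> bot \<and> (\<forall>\<^sub>F S in F. finite_rank_contraction_on Y S) \<and>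
      (\<forall>y\<in>Y. ((\<lambda>S. norm (S y - y)) \<longlongrightarrow> 0) F))"

end

theory Submission
  imports Defs
begin

text \<open>
  The gauge action \<open>u\<^sub>r\<^sub>s \<mapsto> z u\<^sub>r\<^sub>s\<close> (\<open>\<bar>z\<bar> = 1\<close>) commutes with the coproduct in the sense that
  \<open>\<Delta> \<alpha>\<^sub>z = (id \<otimes> \<alpha>\<^sub>z) \<Delta>\<close>; applying the slice map of the Haar state gives \<open>h \<alpha>\<^sub>z = h\<close>, so the action is
  isometric for the norm of the GNS representation. On words without adjoints it acts on those of
  length \<open>k\<close> by \<open>z\<^sup>k\<close>, and there are only finitely many words of each length. Therefore the Fejer means of the
  gauge action are contractions of finite rank on the nonselfadjoint algebra, and they converge
  pointwise to the identity. The means are averages over roots of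
  unity of sufficiently large order, first on finite sums and then extended to the closure.
\<close>

section \<open>Vector-valued Fejer means\<close>

text \<open>Orthogonality of characters. The sum is geometric in \<open>q\<close>, whose
  \<open>M\<close>-th power is 1; exponents below \<open>M\<close> give distinct powers of the
  primitive root, so \<open>q\<close> equals 1 only if \<open>a = b\<close>.\<close>

lemma sum_roots_unity_power:
  fixes M a b :: nat
  defines "\<omega> \<equiv> cis (2 * pi / real M)"
  assumes "a < M" "b < M"
  shows "(\<Sum>m<M. (\<omega> ^ m) ^ a * cnj ((\<omega> ^ m) ^ b)) = (if a = b then of_nat M else 0)"
proof -
  define q where "q = \<omega> ^ a * cnj (\<omega> ^ b)"
  have q: "(\<omega> ^ m) ^ a * cnj ((\<omega> ^ m) ^ b) = q ^ m" for m
    by (simp add: q_def power_mult_distrib mult.commute flip: power_mult)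
  have pow: "\<omega> ^ k = cis (2 * pi * real k / real M)" for k
    unfolding \<omega>_def Complex.DeMoivre by (rule arg_cong[where f = cis]) simp
  have unit: "\<omega> ^ b * cnj (\<omega> ^ b) = 1"
    unfolding pow complex_norm_square[symmetric] by simp
  show ?thesis
  proof (cases "a = b")
    case True
    then have "q = 1" using unit by (simp only: q_def)
    then show ?thesis unfolding q by (simp add: True)
  next
    case False
    have "\<omega> ^ a \<noteq> \<omega> ^ b"
    proof
      assume "\<omega> ^ a = \<omega> ^ b"
      moreover have "inj_on (\<lambda>k. \<omega> ^ k) {..<M}"
        unfolding pow using assms by (intro bij_betw_imp_inj_on[OF Complex.bij_betw_roots_unity]) simp
      ultimately show False
        using assms False by (simp add: inj_on_eq_iff)
    qed
    moreover have "\<omega> ^ a = q * \<omega> ^ b"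
      using unit by (simp add: q_def mult_ac)
    ultimately have "q \<noteq> 1" by auto
    moreover have "q ^ M = 1"
    proof -
      have "\<omega> ^ M = 1" unfolding pow using assms by simp
      then have "(\<omega> ^ k) ^ M = 1" for k
        by (metis power_mult mult.commute power_one)
      then show ?thesis
        unfolding q_def power_mult_distrib complex_cnj_power[symmetric] by simp
    qed
    ultimately show ?thesis
      unfolding q using False by (simp add: geometric_sum)
  qed
qed

text \<open>The squared modulus is \<open>N\<close> times the Fejer kernel. Expanding it, the sum
  over \<open>m\<close> keeps exactly the pairs with \<open>l = j + k\<close>, and there are
  \<open>N - k\<close> of them, which is 0 for \<open>k \<ge> N\<close> thanks to truncated
  subtraction. The bound \<open>N + k \<le> M\<close> keeps all exponents below \<open>M\<close>, so
  that no aliasing occurs.\<close>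

lemma fejer_kernel:
  fixes M N k :: nat
  defines "\<omega> \<equiv> cis (2 * pi / real M)"
  assumes "0 < N" "N + k \<le> M"
  shows "(\<Sum>m<M. complex_of_real ((cmod (\<Sum>j<N. (\<omega> ^ m) ^ j))\<^sup>2) * (\<omega> ^ m) ^ k) = of_nat (M * (N - k))"
proof -
  have "(\<Sum>m<M. complex_of_real ((cmod (\<Sum>j<N. (\<omega> ^ m) ^ j))\<^sup>2) * (\<omega> ^ m) ^ k)
      = (\<Sum>m<M. \<Sum>j<N. \<Sum>l<N. (\<omega> ^ m) ^ (j + k) * cnj ((\<omega> ^ m) ^ l))"
    unfolding complex_norm_square cnj_sum sum_product
    by (simp add: sum_distrib_left power_add mult_ac)
  also have "\<dots> = (\<Sum>j<N. \<Sum>l<N. \<Sum>m<M. (\<omega> ^ m) ^ (j + k) * cnj ((\<omega> ^ m) ^ l))"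
    by (subst sum.swap, rule sum.cong[OF refl], rule sum.swap)
  also have "\<dots> = (\<Sum>j<N. \<Sum>l<N. if j + k = l then of_nat M else 0)"
    unfolding \<omega>_def using assms by (intro sum.cong refl sum_roots_unity_power) auto
  also have "\<dots> = (\<Sum>j<N. if j + k < N then of_nat M else 0)"
    by (intro sum.cong) (auto simp: sum.delta)
  also have "\<dots> = (\<Sum>j\<in>{..<N - k}. of_nat M)"
    by (rule sum.mono_neutral_cong_right) auto
  finally show ?thesis by (simp add: mult.commute)
qed

text \<open>The sum on the left is a convex combination of the rotated sums that
  \<open>bound\<close> controls, with the nonnegative weights \<open>F m / (M * N)\<close>. Only
  finitely many degrees occur in \<open>T\<close>, so an average over roots of unity replaces the
  integral over the circle exactly.\<close>

lemma fejer_bound: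
  fixes Q :: "'i \<Rightarrow> 'b::complex_normed_vector"
  assumes "finite T" "0 < N"
    and bound: "\<And>z. cmod z = 1 \<Longrightarrow> norm (\<Sum>t\<in>T. z ^ d t *\<^sub>C Q t) \<le> C"
  shows "norm (\<Sum>t\<in>T. complex_of_real (real (N - d t) / real N) *\<^sub>C Q t) \<le> C"
proof -
  \<comment> \<open>Any order with \<open>N + d t \<le> M\<close> for all \<open>t\<close> in
    \<open>T\<close> would do; the sum of the degrees is a convenient bound.\<close>
  define M where "M = N + (\<Sum>t\<in>T. d t)"
  have M: "N + d t \<le> M" if "t \<in> T" for t
    using assms(1) that by (auto simp: M_def intro: member_le_sum)
  have pos: "0 < M" using assms by (simp add: M_def)
  define \<omega> where "\<omega> = cis (2 * pi / real M)"
  define F where "F m = (cmod (\<Sum>j<N. (\<omega> ^ m) ^ j))\<^sup>2" for m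
  \<comment> \<open>The coefficient of degree 0 is the total mass, by which the weights are
    normalised.\<close>
  have "complex_of_real (\<Sum>m<M. F m) = complex_of_real (real M * real N)"
    using fejer_kernel[of N 0 M] assms(2) by (simp add: M_def F_def \<omega>_def)
  then have F_sum: "(\<Sum>m<M. F m) = real M * real N"
    using of_real_eq_iff by blast
  have coeff: "complex_of_real (real M * real N) * complex_of_real (real (N - d t) / real N)
      = (\<Sum>m<M. complex_of_real (F m) * (\<omega> ^ m) ^ d t)" if "t \<in> T" for t
    unfolding F_def \<omega>_def fejer_kernel[OF assms(2) M[OF that]] using assms(2) by simp
  have "complex_of_real (real M * real N) *\<^sub>C (\<Sum>t\<in>T. complex_of_real (real (N - d t) / real N) *\<^sub>C Q t)
      = (\<Sum>t\<in>T. (\<Sum>m<M. complex_of_real (F m) * (\<omega> ^ m) ^ d t) *\<^sub>C Q t)"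
    unfolding complex_vector.scale_sum_right scaleC_scaleC
    by (intro sum.cong refl) (simp only: coeff)
  also have "\<dots> = (\<Sum>m<M. complex_of_real (F m) *\<^sub>C (\<Sum>t\<in>T. (\<omega> ^ m) ^ d t *\<^sub>C Q t))"
    unfolding complex_vector.scale_sum_left complex_vector.scale_sum_right scaleC_scaleC
    by (rule sum.swap)
  also have "norm \<dots> \<le> (\<Sum>m<M. F m * C)"
    by (rule sum_norm_le)
      (auto simp: norm_scaleC F_def \<omega>_def norm_power intro!: mult_left_mono bound)
  also have "\<dots> = real M * real N * C"
    by (simp add: F_sum flip: sum_distrib_right)
  finally show ?thesis
    using pos assms(2) by (simp add: norm_scaleC norm_mult)
qed


section \<open>Finite-dimensional subspaces and continuous extension\<close>

lemma bounded_linear_scaleC_left: "bounded_linear (\<lambda>c. c *\<^sub>C (x :: 'a::complex_normed_vector))"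
  by (rule bounded_linear_intro[where K = "norm x"])
    (auto simp: scaleC_add_left norm_scaleC scaleR_conv_of_real scaleC_scaleC simp flip: scaleC_of_real)

lemma subspace_closure:
  assumes "complex_vector.subspace (V :: 'a::complex_normed_vector set)"
  shows "complex_vector.subspace (closure V)"
proof (rule complex_vector.subspaceI)
  show "0 \<in> closure V"
    using complex_vector.subspace_0[OF assms] closure_subset by blast
  show "x + y \<in> closure V" if x: "x \<in> closure V" and y: "y \<in> closure V" for x y
  proof -
    from x obtain u where "\<forall>n. u n \<in> V" "u \<longlonglongrightarrow> x" by (auto simp: closure_sequential)
    moreover from y obtain v where "\<forall>n. v n \<in> V" "v \<longlonglongrightarrow> y" by (auto simp: closure_sequential)
    ultimately show ?thesis
      unfolding closure_sequential using complex_vector.subspace_add[OF assms]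
      by (intro exI[of _ "\<lambda>n. u n + v n"]) (simp add: tendsto_add)
  qed
  show "c *\<^sub>C x \<in> closure V" if x: "x \<in> closure V" for c x
  proof -
    from x obtain u where "\<forall>n. u n \<in> V" "u \<longlonglongrightarrow> x" by (auto simp: closure_sequential)
    then show ?thesis
      unfolding closure_sequential using complex_vector.subspace_scale[OF assms]
      by (intro exI[of _ "\<lambda>n. c *\<^sub>C u n"]) (simp add: bounded_linear.tendsto[OF bounded_linear_scaleC])
  qed
qed

lemma clinear_on_diff:
  assumes "complex_vector.subspace A" "clinear_on A f" "x \<in> A" "y \<in> A"
  shows "f (x - y) = f x - f y"
proof -
  have "f (-1 *\<^sub>C y) = -1 *\<^sub>C f y" and "-1 *\<^sub>C y \<in> A"
    using assms complex_vector.subspace_scale unfolding clinear_on_def by blast+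
  moreover from this have "f (x + -1 *\<^sub>C y) = f x + f (-1 *\<^sub>C y)"
    using assms unfolding clinear_on_def by blast
  ultimately show ?thesis by (simp add: complex_vector.scale_minus_left)
qed

text \<open>By induction: a vector \<open>b\<close> outside a closed subspace has positive distance
  \<open>\<delta>\<close> from it, so the coefficient of \<open>b\<close> in an element of the
  larger span is bounded by the norm divided by \<open>\<delta>\<close>. Along a convergent sequence
  the coefficients are therefore Cauchy, and the remainders converge inside the old span.\<close>

lemma closed_span_finite:
  assumes "finite (B :: 'a::complex_normed_vector set)"
  shows "closed (complex_vector.span B)"
  using assms
proof (induction B)
  case empty
  then show ?case by simp
next
  case (insert b B)
  show ?case
  proof (cases "b \<in> complex_vector.span B")
    case True
    then show ?thesis using insert by (simp add: complex_vector.span_redundant)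
  next
    case False
    with insert.IH obtain \<delta> where "\<delta> > 0" and ball: "ball b \<delta> \<subseteq> - complex_vector.span B"
      by (metis open_contains_ball open_Compl ComplI)
    \<comment> \<open>Dividing by \<open>c\<close> reduces this to the distance from
      \<open>b\<close> to the point \<open>y'\<close> of the span, which lies outside the
      ball.\<close>
    have far: "\<delta> * cmod c \<le> norm (c *\<^sub>C b + y)" if y: "y \<in> complex_vector.span B" for c y
    proof (cases "c = 0")
      case False
      define y' where "y' = - (inverse c *\<^sub>C y)"
      have "y' \<in> complex_vector.span B"
        unfolding y'_def using y by (intro complex_vector.span_neg complex_vector.span_scale)
      then have "\<delta> \<le> norm (b - y')"
        using ball by (force simp: dist_norm)
      moreover have "c *\<^sub>C b + y = c *\<^sub>C (b - y')"
        using False by (simp add: y'_def scaleC_add_right scaleC_scaleC)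
      ultimately have "norm (c *\<^sub>C b + y) = cmod c * norm (b - y')" "cmod c * \<delta> \<le> cmod c * norm (b - y')"
        by (simp_all add: norm_scaleC mult_left_mono)
      then show ?thesis by (simp add: mult.commute)
    qed simp
    show ?thesis
      unfolding closed_sequential_limits
    proof (intro allI impI, elim conjE)
      fix f l assume f: "\<forall>n. f n \<in> complex_vector.span (insert b B)" and lim: "f \<longlonglongrightarrow> l"
      from f obtain k where k: "\<And>n. f n - k n *\<^sub>C b \<in> complex_vector.span B"
        unfolding complex_vector.span_insert mem_Collect_eq by metis
      have le: "\<delta> * dist (k m) (k n) \<le> dist (f m) (f n)" for m n
      proof -
        have "(f m - k m *\<^sub>C b) - (f n - k n *\<^sub>C b) \<in> complex_vector.span B"
          by (rule complex_vector.span_diff[OF k k])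
        from far[OF this, of "k m - k n"] show ?thesis
          by (simp add: dist_norm complex_vector.scale_left_diff_distrib algebra_simps)
      qed
      have "Cauchy k"
      proof (rule metric_CauchyI)
        fix e :: real assume "e > 0"
        then obtain N where N: "\<forall>m\<ge>N. \<forall>n\<ge>N. dist (f m) (f n) < \<delta> * e"
          using metric_CauchyD[OF LIMSEQ_imp_Cauchy[OF lim], of "\<delta> * e"] \<open>\<delta> > 0\<close> by auto
        have "dist (k m) (k n) < e" if "m \<ge> N" "n \<ge> N" for m n
        proof -
          have "\<delta> * dist (k m) (k n) < \<delta> * e"
            using le[of m n] N that by (meson le_less_trans)
          then show ?thesis using \<open>\<delta> > 0\<close> by simp
        qed
        then show "\<exists>M. \<forall>m\<ge>M. \<forall>n\<ge>M. dist (k m) (k n) < e" by blast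
      qed
      then obtain \<kappa> where "k \<longlonglongrightarrow> \<kappa>"
        by (auto simp: Cauchy_convergent_iff convergent_def)
      then have kb: "(\<lambda>n. k n *\<^sub>C b) \<longlonglongrightarrow> \<kappa> *\<^sub>C b"
        by (rule bounded_linear.tendsto[OF bounded_linear_scaleC_left])
      have "(\<lambda>n. f n - k n *\<^sub>C b) \<longlonglongrightarrow> l - \<kappa> *\<^sub>C b"
        by (intro tendsto_diff lim kb)
      then have "l - \<kappa> *\<^sub>C b \<in> complex_vector.span B"
        by (rule closed_sequentially[OF insert.IH k])
      then show "l \<in> complex_vector.span (insert b B)"
        unfolding complex_vector.span_insert by blast
    qed
  qed
qed

text \<open>
  Working with a linear relation avoids choosing representations of the elements of its domain: the
  contraction property makes it single-valued.
\<close>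

lemma contractive_relation_extension:
  fixes R :: "('a::complex_normed_vector \<times> 'b::{complex_normed_vector, banach}) set"
  assumes add: "\<And>x s y t. (x, s) \<in> R \<Longrightarrow> (y, t) \<in> R \<Longrightarrow> (x + y, s + t) \<in> R"
    and scale: "\<And>c x s. (x, s) \<in> R \<Longrightarrow> (c *\<^sub>C x, c *\<^sub>C s) \<in> R"
    and bound: "\<And>x s. (x, s) \<in> R \<Longrightarrow> norm s \<le> norm x"
  shows "\<exists>g. clinear_on (closure (Domain R)) g \<and>
    (\<forall>y\<in>closure (Domain R). norm (g y) \<le> norm y \<and> g y \<in> closure (Range R)) \<and>
    (\<forall>x s. (x, s) \<in> R \<longrightarrow> g x = s)"
proof -
  have seq: "(x, s) \<in> closure R \<longleftrightarrow> (\<exists>u v. (\<forall>n. (u n, v n) \<in> R) \<and> u \<longlonglongrightarrow> x \<and> v \<longlonglongrightarrow> s)" for x s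
  proof
    assume "(x, s) \<in> closure R"
    then obtain p where "\<forall>n. p n \<in> R" "p \<longlonglongrightarrow> (x, s)"
      by (auto simp: closure_sequential)
    then show "\<exists>u v. (\<forall>n. (u n, v n) \<in> R) \<and> u \<longlonglongrightarrow> x \<and> v \<longlonglongrightarrow> s"
      using tendsto_fst[of p "(x, s)"] tendsto_snd[of p "(x, s)"]
      by (intro exI[of _ "\<lambda>n. fst (p n)"] exI[of _ "\<lambda>n. snd (p n)"]) simp
  next
    assume "\<exists>u v. (\<forall>n. (u n, v n) \<in> R) \<and> u \<longlonglongrightarrow> x \<and> v \<longlonglongrightarrow> s"
    then obtain u v where "\<forall>n. (u n, v n) \<in> R" "u \<longlonglongrightarrow> x" "v \<longlonglongrightarrow> s" by blast
    then show "(x, s) \<in> closure R"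
      unfolding closure_sequential
      by (intro exI[of _ "\<lambda>n. (u n, v n)"]) (simp add: tendsto_Pair)
  qed
  have cl_add: "(x + y, s + t) \<in> closure R" if "(x, s) \<in> closure R" "(y, t) \<in> closure R" for x y s t
  proof -
    from that obtain u v u' v' where "\<forall>n. (u n, v n) \<in> R" "u \<longlonglongrightarrow> x" "v \<longlonglongrightarrow> s"
      "\<forall>n. (u' n, v' n) \<in> R" "u' \<longlonglongrightarrow> y" "v' \<longlonglongrightarrow> t"
      unfolding seq by blast
    then show ?thesis
      unfolding seq
      by (intro exI[of _ "\<lambda>n. u n + u' n"] exI[of _ "\<lambda>n. v n + v' n"]) (simp add: add tendsto_add)
  qed
  have cl_scale: "(c *\<^sub>C x, c *\<^sub>C s) \<in> closure R" if xs: "(x, s) \<in> closure R" for c x s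
  proof -
    from xs obtain u v where "\<forall>n. (u n, v n) \<in> R" "u \<longlonglongrightarrow> x" "v \<longlonglongrightarrow> s"
      unfolding seq by blast
    then show ?thesis
      unfolding seq
      by (intro exI[of _ "\<lambda>n. c *\<^sub>C u n"] exI[of _ "\<lambda>n. c *\<^sub>C v n"])
        (simp add: scale bounded_linear.tendsto[OF bounded_linear_scaleC])
  qed
  have cl_bound: "norm s \<le> norm x" if xs: "(x, s) \<in> closure R" for x s
  proof -
    from xs obtain u v where uv: "\<forall>n. (u n, v n) \<in> R" "u \<longlonglongrightarrow> x" "v \<longlonglongrightarrow> s"
      unfolding seq by blast
    show ?thesis
      by (rule LIMSEQ_le[OF tendsto_norm[OF uv(3)] tendsto_norm[OF uv(2)]]) (use uv(1) bound in blast)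
  qed
  \<comment> \<open>The pair \<open>(0, s - t)\<close> lies in the closure as well, and
    \<open>cl_bound\<close> makes its second entry vanish.\<close>
  have unique: "s = t" if "(x, s) \<in> closure R" "(x, t) \<in> closure R" for x s t
    using cl_bound[OF cl_add[OF that(1) cl_scale[OF that(2), of "-1"]]]
    by (simp add: complex_vector.scale_minus_left)
  \<comment> \<open>By \<open>bound\<close>, the second entries of pairs with convergent first
    entries form a Cauchy sequence; completeness of the target gives the value at
    \<open>y\<close>.\<close>
  have total: "\<exists>s. (y, s) \<in> closure R" if y: "y \<in> closure (Domain R)" for y
  proof -
    from y obtain u where u: "\<forall>n. u n \<in> Domain R" "u \<longlonglongrightarrow> y"
      by (auto simp: closure_sequential)
    then obtain v where v: "\<And>n. (u n, v n) \<in> R" unfolding Domain_iff by metis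
    have "Cauchy v"
    proof (rule metric_CauchyI)
      fix e :: real assume "e > 0"
      then obtain N where N: "\<forall>m\<ge>N. \<forall>n\<ge>N. dist (u m) (u n) < e"
        using metric_CauchyD[OF LIMSEQ_imp_Cauchy[OF u(2)]] by blast
      have "dist (v m) (v n) \<le> dist (u m) (u n)" for m n
        using bound[OF add[OF v[of m] scale[OF v[of n], of "-1"]]]
        by (simp add: dist_norm complex_vector.scale_minus_left)
      then show "\<exists>M. \<forall>m\<ge>M. \<forall>n\<ge>M. dist (v m) (v n) < e"
        using N by (meson le_less_trans)
    qed
    then show ?thesis
      using u(2) v unfolding seq Cauchy_convergent_iff convergent_def by blast
  qed
  define g where "g y = (THE s. (y, s) \<in> closure R)" for y
  have g_eq: "g x = s" if "(x, s) \<in> closure R" for x s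
    unfolding g_def using that unique by blast
  have g: "(y, g y) \<in> closure R" if "y \<in> closure (Domain R)" for y
    using total[OF that] g_eq by auto
  show ?thesis
  proof (intro exI[of _ g] conjI ballI allI impI)
    show "clinear_on (closure (Domain R)) g"
      unfolding clinear_on_def using g g_eq cl_add cl_scale by blast
    show "norm (g y) \<le> norm y" if "y \<in> closure (Domain R)" for y
      by (rule cl_bound[OF g[OF that]])
    show "g y \<in> closure (Range R)" if "y \<in> closure (Domain R)" for y
    proof -
      from g[OF that] obtain u v where "\<forall>n. (u n, v n) \<in> R" "v \<longlonglongrightarrow> g y"
        unfolding seq by blast
      then show ?thesis unfolding closure_sequential by blast
    qed
    show "g x = s" if "(x, s) \<in> R" for x s
      using that closure_subset by (blast intro: g_eq)
  qed
qed

section \<open>Metric approximation for the closed span of a graded family\<close>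

text \<open>The approximants are Fejer multipliers, scaling each term of degree \<open>d\<close> by
  the positive part of \<open>1 - d / (N + 1)\<close>. The assumption \<open>gauge\<close> makes
  them contractive through \<open>fejer_bound\<close>, and \<open>fin\<close> makes their rank
  finite.\<close>

lemma metric_approximation_property_graded:
  fixes m :: "'i \<Rightarrow> 'a::{complex_normed_vector, banach}" and d :: "'i \<Rightarrow> nat"
  assumes fin: "\<And>N. finite {t. d t < N}"
    and gauge: "\<And>T c z. finite T \<Longrightarrow> cmod z = 1 \<Longrightarrow>
      norm (\<Sum>t\<in>T. z ^ d t *\<^sub>C c t *\<^sub>C m t) \<le> norm (\<Sum>t\<in>T. c t *\<^sub>C m t)"
  shows "metric_approximation_property (closure (complex_vector.span (range m)))"
proof -
  \<comment> \<open>\<open>Suc N\<close> keeps the denominator positive, and truncated subtraction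
    makes the weight 0 from degree \<open>Suc N\<close> on.\<close>
  define w where "w N t = complex_of_real (real (Suc N - d t) / real (Suc N))" for N t
  \<comment> \<open>The family \<open>m\<close> may be linearly dependent, so the multiplier is
    first only a relation between finite sums.\<close>
  define R where "R N = {(\<Sum>t\<in>T. c t *\<^sub>C m t, \<Sum>t\<in>T. w N t *\<^sub>C c t *\<^sub>C m t) | T c. finite T}" for N
  have R_add: "(x + y, s + t) \<in> R N" if xs: "(x, s) \<in> R N" and yt: "(y, t) \<in> R N" for x y s t N
  proof -
    from xs obtain T c where T: "finite T" "x = (\<Sum>t\<in>T. c t *\<^sub>C m t)" "s = (\<Sum>t\<in>T. w N t *\<^sub>C c t *\<^sub>C m t)"
      unfolding R_def by blast
    from yt obtain T' c' where T': "finite T'" "y = (\<Sum>t\<in>T'. c' t *\<^sub>C m t)" "t = (\<Sum>t\<in>T'. w N t *\<^sub>C c' t *\<^sub>C m t)"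
      unfolding R_def by blast
    \<comment> \<open>Extending both coefficient families by 0 puts the two sums over the common
      index set \<open>T \<union> T'\<close>.\<close>
    define b where "b t = (if t \<in> T then c t else 0)" for t
    define b' where "b' t = (if t \<in> T' then c' t else 0)" for t
    have "x = (\<Sum>t\<in>T \<union> T'. b t *\<^sub>C m t)" "y = (\<Sum>t\<in>T \<union> T'. b' t *\<^sub>C m t)"
      "s = (\<Sum>t\<in>T \<union> T'. w N t *\<^sub>C b t *\<^sub>C m t)" "t = (\<Sum>t\<in>T \<union> T'. w N t *\<^sub>C b' t *\<^sub>C m t)"
      unfolding T T' b_def b'_def using T(1) T'(1)
      by (auto intro!: sum.mono_neutral_cong_left)
    then have "x + y = (\<Sum>t\<in>T \<union> T'. (b t + b' t) *\<^sub>C m t)"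
      "s + t = (\<Sum>t\<in>T \<union> T'. w N t *\<^sub>C (b t + b' t) *\<^sub>C m t)"
      by (simp_all add: scaleC_add_left scaleC_add_right sum.distrib)
    then show ?thesis
      unfolding R_def using T(1) T'(1)
      by (intro CollectI exI[of _ "T \<union> T'"] exI[of _ "\<lambda>t. b t + b' t"]) simp
  qed
  have R_scale: "(a *\<^sub>C x, a *\<^sub>C s) \<in> R N" if xs: "(x, s) \<in> R N" for a x s N
  proof -
    from xs obtain T c where T: "finite T" "x = (\<Sum>t\<in>T. c t *\<^sub>C m t)" "s = (\<Sum>t\<in>T. w N t *\<^sub>C c t *\<^sub>C m t)"
      unfolding R_def by blast
    then have "a *\<^sub>C x = (\<Sum>t\<in>T. (a * c t) *\<^sub>C m t)" "a *\<^sub>C s = (\<Sum>t\<in>T. w N t *\<^sub>C (a * c t) *\<^sub>C m t)"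
      by (simp_all add: complex_vector.scale_sum_right scaleC_scaleC mult_ac)
    then show ?thesis
      unfolding R_def using T(1) by (intro CollectI exI[of _ T] exI[of _ "\<lambda>t. a * c t"]) simp
  qed
  have R_bound: "norm s \<le> norm x" if "(x, s) \<in> R N" for x s N
  proof -
    from that obtain T c where T: "finite T" "x = (\<Sum>t\<in>T. c t *\<^sub>C m t)" "s = (\<Sum>t\<in>T. w N t *\<^sub>C c t *\<^sub>C m t)"
      unfolding R_def by blast
    show ?thesis
      unfolding T(2,3) w_def by (rule fejer_bound[OF T(1) zero_less_Suc gauge[OF T(1)]])
  qed
  have R_dom: "Domain (R N) = complex_vector.span (range m)" for N
  proof
    show "Domain (R N) \<subseteq> complex_vector.span (range m)"
    proof
      fix x assume "x \<in> Domain (R N)"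
      then obtain T c where "x = (\<Sum>t\<in>T. c t *\<^sub>C m t)"
        unfolding R_def by blast
      then show "x \<in> complex_vector.span (range m)"
        by (simp add: complex_vector.span_sum complex_vector.span_scale complex_vector.span_base)
    qed
    have "complex_vector.subspace (Domain (R N))"
    proof (rule complex_vector.subspaceI)
      have "(0, 0) \<in> R N" unfolding R_def by (intro CollectI exI[of _ "{}"]) simp
      then show "0 \<in> Domain (R N)" by blast
      show "x + y \<in> Domain (R N)" if "x \<in> Domain (R N)" "y \<in> Domain (R N)" for x y
        using that R_add unfolding Domain_iff by blast
      show "c *\<^sub>C x \<in> Domain (R N)" if "x \<in> Domain (R N)" for c x
        using that R_scale unfolding Domain_iff by blast
    qed
    moreover have "m t \<in> Domain (R N)" for t
    proof -
      have "(m t, w N t *\<^sub>C m t) \<in> R N"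
        unfolding R_def by (intro CollectI exI[of _ "{t}"] exI[of _ "\<lambda>_. 1"]) simp
      then show ?thesis by blast
    qed
    ultimately show "complex_vector.span (range m) \<subseteq> Domain (R N)"
      by (intro complex_vector.span_minimal) auto
  qed
  define Y where "Y = closure (complex_vector.span (range m))"
  define B where "B N = m ` {t. d t < Suc N}" for N
  have R_rng: "Range (R N) \<subseteq> complex_vector.span (B N)" for N
  proof
    fix s assume "s \<in> Range (R N)"
    then obtain T c where s: "s = (\<Sum>t\<in>T. w N t *\<^sub>C c t *\<^sub>C m t)"
      unfolding R_def by blast
    show "s \<in> complex_vector.span (B N)"
      unfolding s
    proof (rule complex_vector.span_sum)
      fix t
      show "w N t *\<^sub>C c t *\<^sub>C m t \<in> complex_vector.span (B N)"
      proof (cases "d t < Suc N")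
        case True
        then show ?thesis
          unfolding B_def by (intro complex_vector.span_scale complex_vector.span_base) blast
      next
        case False
        then have "w N t = 0" by (simp add: w_def)
        then show ?thesis by (simp add: complex_vector.span_zero)
      qed
    qed
  qed
  have "\<exists>g. clinear_on Y g \<and> (\<forall>y\<in>Y. norm (g y) \<le> norm y) \<and>
      (\<forall>y\<in>Y. g y \<in> complex_vector.span (B N)) \<and> (\<forall>x s. (x, s) \<in> R N \<longrightarrow> g x = s)" for N
  proof -
    \<comment> \<open>The values of the extension are only known to lie in the closure of the range;
      that closure stays within a finite-dimensional span because such a span is closed.\<close>
    have rng: "closure (Range (R N)) \<subseteq> complex_vector.span (B N)"
      by (intro closure_minimal R_rng closed_span_finite) (simp add: B_def fin)
    have "\<exists>g. clinear_on (closure (Domain (R N))) g \<and>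
        (\<forall>y\<in>closure (Domain (R N)). norm (g y) \<le> norm y \<and> g y \<in> closure (Range (R N))) \<and>
        (\<forall>x s. (x, s) \<in> R N \<longrightarrow> g x = s)"
      by (rule contractive_relation_extension) (fact R_add R_scale R_bound)+
    then obtain g where g: "clinear_on Y g" "\<forall>y\<in>Y. norm (g y) \<le> norm y \<and> g y \<in> closure (Range (R N))"
      "\<forall>x s. (x, s) \<in> R N \<longrightarrow> g x = s"
      unfolding R_dom Y_def[symmetric] by (elim exE conjE)
    then show ?thesis
      using rng by (intro exI[of _ g]) blast
  qed
  then obtain S where S_lin: "\<And>N. clinear_on Y (S N)"
    and S_norm: "\<And>N y. y \<in> Y \<Longrightarrow> norm (S N y) \<le> norm y"
    and S_rng: "\<And>N y. y \<in> Y \<Longrightarrow> S N y \<in> complex_vector.span (B N)"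
    and S_R: "\<And>N x s. (x, s) \<in> R N \<Longrightarrow> S N x = s"
    by metis
  have span_Y: "complex_vector.span (range m) \<subseteq> Y"
    unfolding Y_def by (rule closure_subset)
  have B_Y: "complex_vector.span (B N) \<subseteq> Y" for N
    by (rule order_trans[OF complex_vector.span_mono span_Y]) (auto simp: B_def)
  have frc: "finite_rank_contraction_on Y (S N)" for N
    unfolding finite_rank_contraction_on_def
  proof (intro conjI exI[of _ "B N"])
    show "finite (B N)" using fin by (simp add: B_def)
  qed (use S_rng B_Y S_lin S_norm in auto)
  have conv_span: "(\<lambda>N. S N x) \<longlonglongrightarrow> x" if x: "x \<in> complex_vector.span (range m)" for x
  proof -
    \<comment> \<open>The domain is the same for every index; one representation of \<open>x\<close>
      as a finite sum then serves all \<open>N\<close>.\<close>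
    from x have "x \<in> Domain (R 0)" by (simp add: R_dom)
    then obtain T c where T: "finite T" "x = (\<Sum>t\<in>T. c t *\<^sub>C m t)"
      unfolding R_def by blast
    then have "(x, \<Sum>t\<in>T. w N t *\<^sub>C c t *\<^sub>C m t) \<in> R N" for N
      unfolding R_def by blast
    then have S: "S N x = (\<Sum>t\<in>T. w N t *\<^sub>C c t *\<^sub>C m t)" for N
      by (rule S_R)
    have "(\<lambda>N. w N t) \<longlonglongrightarrow> complex_of_real 1" for t
      unfolding w_def
    proof (rule tendsto_of_real, rule Lim_transform_eventually)
      show "(\<lambda>N. 1 - real (d t) * (1 / real (Suc N))) \<longlonglongrightarrow> 1"
        using tendsto_diff[OF tendsto_const tendsto_mult[OF tendsto_const LIMSEQ_Suc[OF lim_1_over_n]], of 1 "real (d t)"]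
        by simp
      \<comment> \<open>Once \<open>N \<ge> d t\<close>, the truncated subtraction is a true
        one.\<close>
      show "\<forall>\<^sub>F N in sequentially. 1 - real (d t) * (1 / real (Suc N)) = real (Suc N - d t) / real (Suc N)"
        using eventually_ge_at_top[of "d t"]
        by eventually_elim (simp add: of_nat_diff field_simps)
    qed
    then have "(\<lambda>N. S N x) \<longlonglongrightarrow> (\<Sum>t\<in>T. complex_of_real 1 *\<^sub>C c t *\<^sub>C m t)"
      unfolding S by (intro tendsto_sum bounded_linear.tendsto[OF bounded_linear_scaleC_left])
    then show ?thesis by (simp add: T)
  qed
  have Y: "complex_vector.subspace Y"
    unfolding Y_def by (intro subspace_closure complex_vector.subspace_span)
  \<comment> \<open>Since all \<open>S N\<close> are contractions, convergence passes from the dense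
    span to its closure.\<close>
  have conv: "(\<lambda>N. norm (S N y - y)) \<longlonglongrightarrow> 0" if y: "y \<in> Y" for y
  proof (rule LIMSEQ_I)
    fix e :: real assume "e > 0"
    with y obtain x where x: "x \<in> complex_vector.span (range m)" "dist x y < e / 3"
      unfolding Y_def closure_approachable by (meson divide_pos_pos zero_less_numeral)
    obtain M where M: "\<forall>N\<ge>M. norm (S N x - x) < e / 3"
      using LIMSEQ_D[OF conv_span[OF x(1)], of "e / 3"] \<open>e > 0\<close> by auto
    have xY: "x \<in> Y" using x span_Y by blast
    have xy: "norm (y - x) < e / 3" using x(2) by (simp add: dist_norm norm_minus_commute)
    have "norm (S N y - y) < e" if "N \<ge> M" for N
    proof -
      have "y - x \<in> Y" by (rule complex_vector.subspace_diff[OF Y y xY])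
      then have "norm (S N y - S N x) \<le> norm (y - x)"
        using S_norm[of "y - x" N] clinear_on_diff[OF Y S_lin y xY] by simp
      moreover have "norm ((S N y - S N x) + (S N x - x) - (y - x))
          \<le> norm (S N y - S N x) + norm (S N x - x) + norm (y - x)"
        by (intro order_trans[OF norm_triangle_ineq4] add_right_mono norm_triangle_ineq)
      moreover have "norm (S N x - x) < e / 3" using M that by blast
      ultimately show ?thesis using xy by simp
    qed
    then show "\<exists>M. \<forall>N\<ge>M. norm (norm (S N y - y) - 0) < e" by auto
  qed
  show ?thesis
    unfolding metric_approximation_property_def Y_def[symmetric]
  proof (intro exI[of _ "filtermap S sequentially"] conjI ballI)
    show "\<forall>\<^sub>F T in filtermap S sequentially. finite_rank_contraction_on Y T"
      by (simp add: eventually_filtermap frc)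
    show "((\<lambda>T. norm (T y - y)) \<longlongrightarrow> 0) (filtermap S sequentially)" if "y \<in> Y" for y
      using conv[OF that] by (simp add: filterlim_filtermap)
  qed (simp add: filtermap_bot_iff)
qed

section \<open>Subalgebras\<close>

lemma unital_subalgebraD:
  assumes "unital_subalgebra M"
  shows "1 \<in> M" "x \<in> M \<Longrightarrow> y \<in> M \<Longrightarrow> x + y \<in> M" "x \<in> M \<Longrightarrow> y \<in> M \<Longrightarrow> x * y \<in> M"
    "x \<in> M \<Longrightarrow> c *\<^sub>C x \<in> M"
  using assms by (auto simp: unital_subalgebra_def)

lemma star_subalgebraD:
  assumes "star_subalgebra M"
  shows "unital_subalgebra M" "1 \<in> M" "x \<in> M \<Longrightarrow> y \<in> M \<Longrightarrow> x + y \<in> M" "x \<in> M \<Longrightarrow> y \<in> M \<Longrightarrow> x * y \<in> M"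
    "x \<in> M \<Longrightarrow> c *\<^sub>C x \<in> M" "x \<in> M \<Longrightarrow> star x \<in> M"
  using assms by (auto simp: star_subalgebra_def unital_subalgebra_def)

lemma star_hom_onD:
  assumes "star_hom_on A f"
  shows "clinear_on A f" "f 1 = 1" "x \<in> A \<Longrightarrow> y \<in> A \<Longrightarrow> f (x + y) = f x + f y"
    "x \<in> A \<Longrightarrow> y \<in> A \<Longrightarrow> f (x * y) = f x * f y" "x \<in> A \<Longrightarrow> f (c *\<^sub>C x) = c *\<^sub>C f x"
    "x \<in> A \<Longrightarrow> f (star x) = star (f x)"
  using assms by (auto simp: star_hom_on_def clinear_on_def)

lemma unital_subalgebra_subspace:
  assumes "unital_subalgebra M"
  shows "complex_vector.subspace M"
proof (rule complex_vector.subspaceI)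
  have "0 *\<^sub>C 1 \<in> M" using assms unfolding unital_subalgebra_def by blast
  then show "0 \<in> M" by simp
qed (use assms in \<open>auto simp: unital_subalgebra_def\<close>)

lemma unital_subalgebra_hull: "unital_subalgebra (unital_subalgebra hull S)"
  by (rule hull_in) (auto simp: unital_subalgebra_def)

lemma star_subalgebra_hull: "star_subalgebra (star_subalgebra hull S)"
  by (rule hull_in) (auto simp: star_subalgebra_def unital_subalgebra_def)

lemma star_subalgebra_closure:
  assumes "star_subalgebra M"
  shows "star_subalgebra (closure M)"
proof -
  have sub: "complex_vector.subspace (closure M)"
    using assms by (intro subspace_closure unital_subalgebra_subspace) (simp add: star_subalgebra_def)
  have "x * y \<in> closure M" if x: "x \<in> closure M" and y: "y \<in> closure M" for x y
  proof -
    from x obtain u where "\<forall>n. u n \<in> M" "u \<longlonglongrightarrow> x" by (auto simp: closure_sequential)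
    moreover from y obtain v where "\<forall>n. v n \<in> M" "v \<longlonglongrightarrow> y" by (auto simp: closure_sequential)
    ultimately show ?thesis
      unfolding closure_sequential using assms
      by (intro exI[of _ "\<lambda>n. u n * v n"]) (simp add: tendsto_mult star_subalgebra_def unital_subalgebra_def)
  qed
  moreover have "star x \<in> closure M" if x: "x \<in> closure M" for x
  proof -
    from x obtain u where "\<forall>n. u n \<in> M" "u \<longlonglongrightarrow> x" by (auto simp: closure_sequential)
    then show ?thesis
      unfolding closure_sequential using assms
      by (intro exI[of _ "\<lambda>n. star (u n)"])
        (simp add: bounded_linear.tendsto[OF bounded_linear_star] star_subalgebra_def)
  qed
  moreover have "1 \<in> closure M"
    using assms closure_subset unfolding star_subalgebra_def unital_subalgebra_def by blast
  ultimately show ?thesis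
    using complex_vector.subspace_add[OF sub] complex_vector.subspace_scale[OF sub]
    by (simp add: star_subalgebra_def unital_subalgebra_def)
qed

text \<open>Products of words are concatenations and the empty word is the unit, so the span of the
  words is already an algebra. This supplies the spanning family that is graded by word
  length.\<close>

lemma unital_subalgebra_hull_range:
  fixes f :: "'i \<Rightarrow> 'a::cstar_algebra"
  shows "unital_subalgebra hull (range f) = complex_vector.span (range (\<lambda>w. prod_list (map f w)))"
    (is "?H = complex_vector.span (range ?m)")
proof
  \<comment> \<open>Closure under products is proved one factor at a time: first a word on the left,
    then an arbitrary element.\<close>
  have word_mult: "?m w * y \<in> complex_vector.span (range ?m)"
    if "y \<in> complex_vector.span (range ?m)" for w y
  proof -
    have "complex_vector.subspace {y. ?m w * y \<in> complex_vector.span (range ?m)}"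
      by (rule complex_vector.subspaceI)
        (simp_all add: distrib_left mult_scaleC_right complex_vector.span_zero
          complex_vector.span_add complex_vector.span_scale)
    moreover have "?m w * ?m v \<in> complex_vector.span (range ?m)" for v
      by (rule complex_vector.span_base, rule range_eqI[of _ _ "w @ v"]) simp
    ultimately have "complex_vector.span (range ?m) \<subseteq> {y. ?m w * y \<in> complex_vector.span (range ?m)}"
      by (intro complex_vector.span_minimal) auto
    then show ?thesis using that by blast
  qed
  have mult: "x * y \<in> complex_vector.span (range ?m)"
    if "x \<in> complex_vector.span (range ?m)" "y \<in> complex_vector.span (range ?m)" for x y
  proof -
    have "complex_vector.subspace {x. x * y \<in> complex_vector.span (range ?m)}"
      by (rule complex_vector.subspaceI)
        (simp_all add: distrib_right mult_scaleC_left complex_vector.span_zero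
          complex_vector.span_add complex_vector.span_scale)
    then have "complex_vector.span (range ?m) \<subseteq> {x. x * y \<in> complex_vector.span (range ?m)}"
      using word_mult[OF that(2)] by (intro complex_vector.span_minimal) auto
    then show ?thesis using that by blast
  qed
  show "?H \<subseteq> complex_vector.span (range ?m)"
  proof (rule hull_minimal)
    have "f i = ?m [i]" for i by simp
    then show "range f \<subseteq> complex_vector.span (range ?m)"
      by (intro subsetI) (metis complex_vector.span_base rangeE rangeI)
    have "?m [] \<in> complex_vector.span (range ?m)"
      by (rule complex_vector.span_base) blast
    then show "unital_subalgebra (complex_vector.span (range ?m))"
      by (simp add: unital_subalgebra_def mult complex_vector.span_add complex_vector.span_scale)
  qed
  have "?m w \<in> ?H" for w
  proof (induction w)
    case Nil
    show ?case by (simp add: unital_subalgebraD[OF unital_subalgebra_hull])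
  next
    case (Cons i w)
    moreover have "f i \<in> ?H" by (rule hull_inc) blast
    ultimately show ?case by (simp add: unital_subalgebraD[OF unital_subalgebra_hull])
  qed
  then show "complex_vector.span (range ?m) \<subseteq> ?H"
    by (intro complex_vector.span_minimal unital_subalgebra_subspace unital_subalgebra_hull) auto
qed


section \<open>State-preserving automorphisms in the GNS representation\<close>

lemma norm_bop_le_dense:
  assumes "closure D = UNIV" "0 \<le> K" "\<And>x. x \<in> D \<Longrightarrow> norm (bop_apply A x) \<le> K * norm x"
  shows "norm A \<le> K"
proof (rule norm_bop_bound[OF assms(2)])
  fix x
  obtain u where u: "\<forall>n. u n \<in> D" "u \<longlonglongrightarrow> x"
    using assms(1) closure_sequential[of x D] by auto
  have "bounded_linear (bop_apply A)"
    unfolding bop_apply.rep_eq by (rule blinfun.bounded_linear_right)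
  then have "(\<lambda>n. norm (bop_apply A (u n))) \<longlonglongrightarrow> norm (bop_apply A x)"
    by (intro tendsto_norm bounded_linear.tendsto[OF _ u(2)])
  moreover have "(\<lambda>n. K * norm (u n)) \<longlonglongrightarrow> K * norm x"
    by (intro tendsto_mult tendsto_const tendsto_norm u(2))
  ultimately show "norm (bop_apply A x) \<le> K * norm x"
    by (rule LIMSEQ_le) (use u(1) assms(3) in blast)
qed

text \<open>Norms of vectors in the cyclic orbit depend on the state alone; this is how invariance
  of \<open>h\<close> turns into isometry.\<close>

lemma norm_gns_vector:
  assumes "star_subalgebra A" "gns_representation A h \<pi> \<xi>" "a \<in> A"
  shows "complex_of_real ((norm (bop_apply (\<pi> a) \<xi>))\<^sup>2) = h (star a * a)"
proof -
  have hom: "star_hom_on A \<pi>" and h: "\<And>b. b \<in> A \<Longrightarrow> cinner \<xi> (bop_apply (\<pi> b) \<xi>) = h b"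
    using assms(2) by (simp_all add: gns_representation_def)
  have "star a \<in> A" "star a * a \<in> A"
    using assms by (simp_all add: star_subalgebraD)
  then have "h (star a * a) = cinner \<xi> (bop_apply (star (\<pi> a) * \<pi> a) \<xi>)"
    using assms(3) by (simp add: star_hom_onD[OF hom] flip: h)
  also have "\<dots> = cinner (bop_apply (\<pi> a) \<xi>) (bop_apply (\<pi> a) \<xi>)"
    by (simp add: bop_apply_mult star_bop_right)
  finally show ?thesis by (simp add: cinner_self)
qed

text \<open>The bound \<open>cmod (h a) \<le> norm a\<close> and the C*-identity give
  \<open>norm (bop_apply (\<pi> a) \<xi>) \<le> norm a\<close>. Hence the orbit map is continuous
  and sends the dense set \<open>M\<close> to a dense set, which lets later arguments stay within
  the *-polynomials.\<close>

lemma gns_dense: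
  assumes M: "star_subalgebra M" and h: "state_on (closure M) h"
    and gns: "gns_representation (closure M) h \<pi> \<xi>"
  shows "closure ((\<lambda>a. bop_apply (\<pi> a) \<xi>) ` M) = UNIV"
proof -
  have A: "star_subalgebra (closure M)" by (rule star_subalgebra_closure[OF M])
  then have sub: "complex_vector.subspace (closure M)"
    by (intro unital_subalgebra_subspace) (simp add: star_subalgebra_def)
  have \<pi>: "clinear_on (closure M) \<pi>"
    using gns by (simp add: gns_representation_def star_hom_on_def)
  have le: "norm (bop_apply (\<pi> a) \<xi>) \<le> norm a" if a: "a \<in> closure M" for a
  proof -
    have "star a * a \<in> closure M"
      using A a by (simp add: star_subalgebra_def unital_subalgebra_def)
    then have "cmod (h (star a * a)) \<le> (norm a)\<^sup>2"
      using h by (auto simp: state_on_def simp flip: cstar_identity)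
    then have "(norm (bop_apply (\<pi> a) \<xi>))\<^sup>2 \<le> (norm a)\<^sup>2"
      by (simp flip: norm_gns_vector[OF A gns a] add: norm_power)
    then show ?thesis by (rule power2_le_imp_le) simp
  qed
  have "bop_apply (\<pi> a) \<xi> \<in> closure ((\<lambda>a. bop_apply (\<pi> a) \<xi>) ` M)" if a: "a \<in> closure M" for a
  proof -
    from a obtain u where u: "\<forall>n. u n \<in> M" "u \<longlonglongrightarrow> a" by (auto simp: closure_sequential)
    have uA: "u n \<in> closure M" for n using u(1) closure_subset by blast
    have "norm (bop_apply (\<pi> (u n)) \<xi> - bop_apply (\<pi> a) \<xi>) \<le> norm (u n - a)" for n
    proof -
      have "bop_apply (\<pi> (u n - a)) \<xi> = bop_apply (\<pi> (u n)) \<xi> - bop_apply (\<pi> a) \<xi>"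
        unfolding clinear_on_diff[OF sub \<pi> uA a]
        by (metis add_diff_cancel_right' bop_apply_add diff_add_cancel)
      then show ?thesis
        using le[OF complex_vector.subspace_diff[OF sub uA[of n] a]] by simp
    qed
    then have "(\<lambda>n. bop_apply (\<pi> (u n)) \<xi>) \<longlonglongrightarrow> bop_apply (\<pi> a) \<xi>"
      by (intro LIM_zero_cancel[OF Lim_null_comparison[OF _ tendsto_norm_zero[OF LIM_zero[OF u(2)]]]]) auto
    then show ?thesis
      unfolding closure_sequential using u(1) by (intro exI[of _ "\<lambda>n. bop_apply (\<pi> (u n)) \<xi>"]) auto
  qed
  then have "closure ((\<lambda>a. bop_apply (\<pi> a) \<xi>) ` closure M) \<subseteq> closure ((\<lambda>a. bop_apply (\<pi> a) \<xi>) ` M)"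
    by (intro closure_minimal) auto
  then show ?thesis
    using gns by (auto simp: gns_representation_def)
qed

text \<open>
  The map \<open>\<pi>(b)\<xi> \<mapsto> \<pi>(\<alpha>(b))\<xi>\<close> is isometric on a dense subspace, and it intertwines \<open>\<pi>(a)\<close> with
  \<open>\<pi>(\<alpha>(a))\<close>.
\<close>

lemma gns_automorphism_contractive:
  assumes M: "star_subalgebra M" and h: "state_on (closure M) h"
    and gns: "gns_representation (closure M) h \<pi> \<xi>"
    and \<alpha>_M: "\<And>a. a \<in> M \<Longrightarrow> \<alpha> a \<in> M" and \<beta>_M: "\<And>a. a \<in> M \<Longrightarrow> \<beta> a \<in> M"
    and inverse: "\<And>a. a \<in> M \<Longrightarrow> \<alpha> (\<beta> a) = a"
    and \<alpha>_mult: "\<And>a b. \<alpha> (a * b) = \<alpha> a * \<alpha> b" and \<alpha>_star: "\<And>a. \<alpha> (star a) = star (\<alpha> a)"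
    and invariant: "\<And>a. a \<in> M \<Longrightarrow> h (\<alpha> a) = h a"
    and a: "a \<in> M"
  shows "norm (\<pi> (\<alpha> a)) \<le> norm (\<pi> a)"
proof (rule norm_bop_le_dense[OF gns_dense[OF M h gns] norm_ge_zero])
  have M_mult: "x * y \<in> M" if "x \<in> M" "y \<in> M" for x y
    using M that by (simp add: star_subalgebra_def unital_subalgebra_def)
  have cl: "x \<in> closure M" if "x \<in> M" for x
    using that closure_subset by blast
  have \<pi>_mult: "\<pi> (x * y) = \<pi> x * \<pi> y" if "x \<in> M" "y \<in> M" for x y
    using gns cl that by (simp add: gns_representation_def star_hom_on_def)
  have iso: "norm (bop_apply (\<pi> (\<alpha> b)) \<xi>) = norm (bop_apply (\<pi> b) \<xi>)" if b: "b \<in> M" for b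
  proof -
    have "star b * b \<in> M"
      using M b by (simp add: star_subalgebra_def unital_subalgebra_def)
    then have "complex_of_real ((norm (bop_apply (\<pi> (\<alpha> b)) \<xi>))\<^sup>2) = of_real ((norm (bop_apply (\<pi> b) \<xi>))\<^sup>2)"
      unfolding norm_gns_vector[OF star_subalgebra_closure[OF M] gns cl[OF b]]
        norm_gns_vector[OF star_subalgebra_closure[OF M] gns cl[OF \<alpha>_M[OF b]]]
      by (simp add: invariant flip: \<alpha>_star \<alpha>_mult)
    then show ?thesis
      unfolding of_real_eq_iff by (simp add: power2_eq_iff_nonneg)
  qed
  fix x assume "x \<in> (\<lambda>a. bop_apply (\<pi> a) \<xi>) ` M"
  then obtain b where b: "b \<in> M" and x: "x = bop_apply (\<pi> b) \<xi>" by blast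
  \<comment> \<open>Writing \<open>b\<close> as \<open>\<alpha> (\<beta> b)\<close> puts both
    factors under one \<open>\<alpha>\<close>, which \<open>iso\<close> then removes from the
    norm.\<close>
  have "bop_apply (\<pi> (\<alpha> a)) x = bop_apply (\<pi> (\<alpha> (a * \<beta> b))) \<xi>"
    by (simp add: x a b \<alpha>_mult inverse \<pi>_mult \<alpha>_M \<beta>_M flip: bop_apply_mult)
  then have "norm (bop_apply (\<pi> (\<alpha> a)) x) = norm (bop_apply (\<pi> (a * \<beta> b)) \<xi>)"
    using a b by (simp add: iso M_mult \<beta>_M)
  also have "\<dots> = norm (bop_apply (\<pi> a) (bop_apply (\<pi> (\<beta> b)) \<xi>))"
    using a b by (simp add: \<pi>_mult \<beta>_M bop_apply_mult)
  also have "\<dots> \<le> norm (\<pi> a) * norm (bop_apply (\<pi> (\<beta> b)) \<xi>)"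
    by (rule norm_bop_apply)
  also have "norm (bop_apply (\<pi> (\<beta> b)) \<xi>) = norm x"
    using iso[OF \<beta>_M[OF b]] by (simp add: inverse b x)
  finally show "norm (bop_apply (\<pi> (\<alpha> a)) x) \<le> norm (\<pi> a) * norm x" .
qed


section \<open>The gauge action\<close>

text \<open>Elements of the algebras are functions on points, so both gauge actions arise by moving
  the points; being pullbacks, they are contractive unital *-homomorphisms.\<close>

definition pullback ::
  "('x::metric_space \<Rightarrow> 'y::metric_space) \<Rightarrow> ('y \<Rightarrow>\<^sub>C 'b::cstar_algebra) \<Rightarrow> 'x \<Rightarrow>\<^sub>C 'b" where
  "pullback f a = Bcontfun (\<lambda>x. apply_bcontfun a (f x))"

lemma pullback_apply:
  assumes "continuous_on UNIV f"
  shows "apply_bcontfun (pullback f a) x = apply_bcontfun a (f x)"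
proof -
  have "continuous_on UNIV (\<lambda>x. apply_bcontfun a (f x))"
    by (rule continuous_on_compose2[OF continuous_on_apply_bcontfun[of UNIV a] assms]) auto
  then have "(\<lambda>x. apply_bcontfun a (f x)) \<in> bcontfun"
    by (rule bcontfun_normI) (rule norm_bounded)
  then show ?thesis by (simp add: pullback_def Bcontfun_inverse)
qed

lemma pullback_hom:
  assumes "continuous_on UNIV f"
  shows "pullback f (a + b) = pullback f a + pullback f b"
    "pullback f (c *\<^sub>C a) = c *\<^sub>C pullback f a"
    "pullback f 1 = 1"
    "pullback f (a * b) = pullback f a * pullback f b"
    "pullback f (star a) = star (pullback f a)"
  by (auto intro!: bcontfun_eqI simp: pullback_apply[OF assms])

lemma norm_pullback_le:
  assumes "continuous_on UNIV f"
  shows "norm (pullback f a) \<le> norm a"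
  by (rule norm_bound) (simp add: pullback_apply[OF assms] norm_bounded)

lemma bounded_linear_pullback:
  assumes "continuous_on UNIV f"
  shows "bounded_linear (pullback f)"
  by (rule bounded_linear_intro[where K = 1])
    (simp_all add: pullback_hom[OF assms] norm_pullback_le[OF assms] flip: scaleC_of_real)

lemma unitary_matrix_scaleC:
  assumes "unitary_matrix V" "cmod z = 1"
  shows "unitary_matrix (\<chi> r s. z *\<^sub>C V $ r $ s)"
proof -
  have z: "z * cnj z = 1"
    using assms(2) by (simp flip: complex_norm_square)
  have "(\<chi> r s. z *\<^sub>C V $ r $ s) ** adjoint_matrix (\<chi> r s. z *\<^sub>C V $ r $ s) = V ** adjoint_matrix V"
    "adjoint_matrix (\<chi> r s. z *\<^sub>C V $ r $ s) ** (\<chi> r s. z *\<^sub>C V $ r $ s) = adjoint_matrix V ** V"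
    using z by (simp_all add: matrix_matrix_mult_def adjoint_matrix_def vec_eq_iff star_scaleC
        mult_scaleC_left mult_scaleC_right mult.commute[of "cnj z"])
  then show ?thesis using assms(1) by (simp add: unitary_matrix_def)
qed

text \<open>Only for \<open>cmod z = 1\<close> is the scaled matrix certain to be biunitary; without
  this nothing is claimed about the matrix of the new point, but the pullback is still a
  homomorphism.\<close>

definition phase_shift :: "complex \<Rightarrow> 'n::finite biunitary \<Rightarrow> 'n biunitary" where
  "phase_shift z V = Abs_biunitary (\<chi> r s. z *\<^sub>C biunitary_matrix V $ r $ s)"

lemma biunitary_matrix_phase_shift:
  fixes V :: "'n::finite biunitary"
  assumes "cmod z = 1"
  shows "biunitary_matrix (phase_shift z V) = (\<chi> r s. z *\<^sub>C biunitary_matrix V $ r $ s)"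
proof -
  \<comment> \<open>Entrywise adjoints turn \<open>z\<close> into \<open>cnj z\<close>, which has
    modulus 1 too, so both unitarity conditions survive.\<close>
  have "conj_matrix (\<chi> r s. z *\<^sub>C W $ r $ s) = (\<chi> r s. cnj z *\<^sub>C conj_matrix W $ r $ s)"
    for W :: "nat ell2 bop^'n^'n"
    by (simp add: conj_matrix_def vec_eq_iff star_scaleC)
  then show ?thesis
    unfolding phase_shift_def using biunitary_matrix[of V] assms
    by (intro Abs_biunitary_inverse CollectI conjI) (simp_all add: unitary_matrix_scaleC)
qed

definition gauge_aut :: "complex \<Rightarrow> 'n::finite rep_fun \<Rightarrow> 'n rep_fun" where
  "gauge_aut z = pullback (phase_shift z)"

lemma gauge_aut_hom:
  "gauge_aut z (a + b) = gauge_aut z a + gauge_aut z b"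
  "gauge_aut z (c *\<^sub>C a) = c *\<^sub>C gauge_aut z a"
  "gauge_aut z 1 = 1"
  "gauge_aut z (a * b) = gauge_aut z a * gauge_aut z b"
  "gauge_aut z (star a) = star (gauge_aut z a)"
  unfolding gauge_aut_def by (rule pullback_hom[OF continuous_on_biunitary])+

lemma gauge_aut_generator: "cmod z = 1 \<Longrightarrow> gauge_aut z (generator r s) = z *\<^sub>C generator r s"
  by (rule bcontfun_eqI)
    (simp add: gauge_aut_def pullback_apply[OF continuous_on_biunitary] generator_apply biunitary_matrix_phase_shift)

text \<open>Provides the inverse \<open>\<beta>\<close> required by
  \<open>gns_automorphism_contractive\<close>: on points the two phases cancel.\<close>

lemma gauge_aut_cnj:
  fixes a :: "'n::finite rep_fun"
  assumes "cmod z = 1"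
  shows "gauge_aut z (gauge_aut (cnj z) a) = a"
proof (rule bcontfun_eqI)
  fix V :: "'n biunitary"
  have "cnj z * z = 1"
    using assms by (simp flip: complex_norm_square add: mult.commute)
  then have "biunitary_matrix (phase_shift (cnj z) (phase_shift z V)) = biunitary_matrix V"
    using assms by (simp add: biunitary_matrix_phase_shift vec_eq_iff)
  then have "phase_shift (cnj z) (phase_shift z V) = V"
    by (simp add: biunitary_matrix_inject)
  then show "apply_bcontfun (gauge_aut z (gauge_aut (cnj z) a)) V = apply_bcontfun a V"
    by (simp add: gauge_aut_def pullback_apply[OF continuous_on_biunitary])
qed

definition polynomials :: "'n::finite rep_fun set" where
  "polynomials = star_subalgebra hull {generator r s | r s. True}"

lemma star_subalgebra_polynomials: "star_subalgebra polynomials"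
  unfolding polynomials_def by (rule star_subalgebra_hull)

lemma closure_polynomials: "closure polynomials = A_u"
  by (simp add: polynomials_def A_u_def)

lemma star_subalgebra_A_u: "star_subalgebra A_u"
  unfolding closure_polynomials[symmetric] by (intro star_subalgebra_closure star_subalgebra_polynomials)

lemma polynomials_subset_A_u: "polynomials \<subseteq> A_u"
  unfolding closure_polynomials[symmetric] by (rule closure_subset)

lemma generator_polynomials: "generator r s \<in> polynomials"
  unfolding polynomials_def by (rule hull_inc) blast

lemma gauge_aut_polynomials:
  fixes a :: "'n::finite rep_fun"
  assumes z: "cmod z = 1" and a: "a \<in> polynomials"
  shows "gauge_aut z a \<in> polynomials"
  using a unfolding polynomials_def[where 'n = 'n]
proof (rule hull_induct, fold polynomials_def)
  note P = star_subalgebraD[OF star_subalgebra_polynomials]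
  show "star_subalgebra {a :: 'n rep_fun. gauge_aut z a \<in> polynomials}"
    by (simp add: star_subalgebra_def unital_subalgebra_def gauge_aut_hom P)
  show "gauge_aut z a \<in> polynomials" if "a \<in> {generator r s | r s. True}" for a :: "'n rep_fun"
    using that by (auto simp: gauge_aut_generator[OF z] P generator_polynomials)
qed

lemma gauge_aut_A_u:
  assumes z: "cmod z = 1" and a: "a \<in> A_u"
  shows "gauge_aut z a \<in> A_u"
proof -
  from a obtain u where u: "\<forall>n. u n \<in> polynomials" "u \<longlonglongrightarrow> a"
    by (auto simp: closure_sequential simp flip: closure_polynomials)
  have "(\<lambda>n. gauge_aut z (u n)) \<longlonglongrightarrow> gauge_aut z a"
    unfolding gauge_aut_def by (rule bounded_linear.tendsto[OF bounded_linear_pullback[OF continuous_on_biunitary] u(2)])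
  then show ?thesis
    unfolding closure_polynomials[symmetric] closure_sequential
    using u(1) gauge_aut_polynomials[OF z] by (intro exI[of _ "\<lambda>n. gauge_aut z (u n)"]) blast
qed

section \<open>Gauge action on the second tensor leg and invariance of the Haar state\<close>

text \<open>This is the map \<open>id \<otimes> \<alpha>\<close> for the gauge automorphism
  \<open>\<alpha>\<close>, realised on all functions of two points by rotating the second
  one.\<close>

definition right_gauge :: "complex \<Rightarrow> 'n::finite rep_fun2 \<Rightarrow> 'n rep_fun2" where
  "right_gauge z = pullback (\<lambda>(V, W). (V, phase_shift z W))"

lemma right_gauge_hom:
  "right_gauge z (a + b) = right_gauge z a + right_gauge z b"
  "right_gauge z (c *\<^sub>C a) = c *\<^sub>C right_gauge z a"
  "right_gauge z 1 = 1"
  "right_gauge z (a * b) = right_gauge z a * right_gauge z b"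
  "right_gauge z (star a) = star (right_gauge z a)"
  unfolding right_gauge_def by (rule pullback_hom[OF continuous_on_biunitary_prod])+

lemma right_gauge_tensor:
  fixes a b :: "'n::finite rep_fun"
  shows "right_gauge z (a \<otimes>\<^sub>f b) = a \<otimes>\<^sub>f gauge_aut z b"
proof (rule bcontfun_eqI)
  fix p :: "'n biunitary \<times> 'n biunitary"
  obtain V W where p: "p = (V, W)" by (cases p)
  show "apply_bcontfun (right_gauge z (a \<otimes>\<^sub>f b)) p = apply_bcontfun (a \<otimes>\<^sub>f gauge_aut z b) p"
    by (simp add: p right_gauge_def gauge_aut_def pullback_apply[OF continuous_on_biunitary_prod]
        pullback_apply[OF continuous_on_biunitary] tensor_fun_apply)
qed

lemma tensor_fun_scaleC_right:
  fixes a b :: "'n::finite rep_fun"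
  shows "a \<otimes>\<^sub>f (c *\<^sub>C b) = c *\<^sub>C (a \<otimes>\<^sub>f b)"
proof (rule bcontfun_eqI)
  fix p :: "'n biunitary \<times> 'n biunitary"
  obtain V W where p: "p = (V, W)" by (cases p)
  have "tensor_op S (c *\<^sub>C T) = c *\<^sub>C tensor_op S T" for S :: "nat ell2 bop" and T :: "nat ell2 bop"
  proof (rule tensor_op_unique)
    fix x y :: "nat ell2"
    show "bop_apply (tensor_op S (c *\<^sub>C T)) (tensor_vec x y) = bop_apply (c *\<^sub>C tensor_op S T) (tensor_vec x y)"
      by (rule ell2_eqI) (auto simp: tensor_op_apply bop_apply_scaleC tensor_vec.rep_eq)
  qed
  then show "apply_bcontfun (a \<otimes>\<^sub>f (c *\<^sub>C b)) p = apply_bcontfun (c *\<^sub>C (a \<otimes>\<^sub>f b)) p"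
    by (simp add: p tensor_fun_apply)
qed

text \<open>
  The identity is only claimed on the *-polynomials, where it follows from the values on the generators:
  this way the continuity of *-homomorphisms is not needed.
\<close>

lemma coproduct_gauge:
  fixes a :: "'n::finite rep_fun"
  assumes \<Delta>: "coproduct \<Delta>" and z: "cmod z = 1" and a: "a \<in> polynomials"
  shows "\<Delta> (gauge_aut z a) = right_gauge z (\<Delta> a)"
proof -
  have hom: "star_hom_on A_u \<Delta>"
    and gen: "\<Delta> (generator r s) = (\<Sum>k\<in>UNIV. generator r k \<otimes>\<^sub>f generator k s)" for r s
    using \<Delta> by (auto simp: coproduct_def)
  have "a \<in> A_u \<and> \<Delta> (gauge_aut z a) = right_gauge z (\<Delta> a)"
    using a unfolding polynomials_def[where 'n = 'n]
  proof (rule hull_induct)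
    \<comment> \<open>Membership in \<open>A_u\<close> is carried along because
      \<open>\<Delta>\<close> is a homomorphism only there.\<close>
    show "star_subalgebra {a. a \<in> A_u \<and> \<Delta> (gauge_aut z a) = right_gauge z (\<Delta> a)}"
      unfolding star_subalgebra_def unital_subalgebra_def
      by (simp add: gauge_aut_hom right_gauge_hom gauge_aut_A_u[OF z] star_hom_onD[OF hom]
          star_subalgebraD[OF star_subalgebra_A_u])
    fix a :: "'n rep_fun" assume "a \<in> {generator r s | r s. True}"
    then obtain r s where a: "a = generator r s" by blast
    have sum: "right_gauge z (sum f K) = (\<Sum>k\<in>K. right_gauge z (f k))" for f and K :: "'n set"
      using right_gauge_hom(2)[of z 0]
      by (induction K rule: infinite_finite_induct) (auto simp: right_gauge_hom)
    have "\<Delta> (gauge_aut z a) = z *\<^sub>C \<Delta> a"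
      by (simp add: a gauge_aut_generator[OF z] star_hom_onD(5)[OF hom A_u_generators(3)])
    also have "\<dots> = right_gauge z (\<Delta> a)"
      by (simp add: a gen sum right_gauge_tensor gauge_aut_generator[OF z] tensor_fun_scaleC_right
          complex_vector.scale_sum_right)
    finally show "a \<in> A_u \<and> \<Delta> (gauge_aut z a) = right_gauge z (\<Delta> a)"
      using a A_u_generators(3) by blast
  qed
  then show ?thesis ..
qed

text \<open>The slice acts on the first leg and the rotation on the second: on
  \<open>a \<otimes>\<^sub>f b\<close> both sides are \<open>h a\<close> times the rotated
  \<open>b\<close>. Linearity and boundedness of the slice extend this to the closure.\<close>

lemma left_slice_right_gauge:
  fixes x :: "'n::finite rep_fun2"
  assumes L: "left_slice h L" and z: "cmod z = 1" and x: "x \<in> A_u_tensor"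
  shows "L (right_gauge z x) = gauge_aut z (L x)"
proof -
  define P where "P = complex_vector.span {a \<otimes>\<^sub>f b | a b. a \<in> A_u \<and> b \<in> (A_u :: 'n rep_fun set)}"
  have T: "A_u_tensor = closure P" by (simp add: A_u_tensor_def P_def)
  have sub: "complex_vector.subspace (A_u_tensor :: 'n rep_fun2 set)"
    unfolding T P_def by (intro subspace_closure complex_vector.subspace_span)
  have P_T: "P \<subseteq> A_u_tensor" unfolding T by (rule closure_subset)
  have lin: "clinear_on A_u_tensor L" and tens: "\<And>a b. a \<in> A_u \<Longrightarrow> b \<in> A_u \<Longrightarrow> L (a \<otimes>\<^sub>f b) = h a *\<^sub>C b"
    using L by (auto simp: left_slice_def)
  obtain K where K: "\<And>x. x \<in> A_u_tensor \<Longrightarrow> norm (L x) \<le> K * norm x"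
    using L unfolding left_slice_def by blast
  \<comment> \<open>Linearity and the bound are available only on \<open>A_u_tensor\<close>, so
    continuity is stated for sequences and limits inside it.\<close>
  have L_lim: "(\<lambda>n. L (u n)) \<longlonglongrightarrow> L y" if u: "\<And>n. u n \<in> A_u_tensor" "u \<longlonglongrightarrow> y" and y: "y \<in> A_u_tensor" for u y
  proof (rule LIM_zero_cancel, rule Lim_null_comparison)
    show "\<forall>\<^sub>F n in sequentially. norm (L (u n) - L y) \<le> K * norm (u n - y)"
      using K[OF complex_vector.subspace_diff[OF sub u(1) y]]
      by (simp flip: clinear_on_diff[OF sub lin u(1) y])
    show "(\<lambda>n. K * norm (u n - y)) \<longlonglongrightarrow> 0"
      by (intro tendsto_mult_right_zero tendsto_norm_zero LIM_zero u(2))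
  qed
  \<comment> \<open>Both \<open>x\<close> and its rotation are kept in \<open>P\<close>, so that
    linearity of \<open>L\<close> applies to each of them.\<close>
  define G where "G = {x. x \<in> P \<and> right_gauge z x \<in> P \<and> L (right_gauge z x) = gauge_aut z (L x)}"
  have "complex_vector.subspace G"
  proof (rule complex_vector.subspaceI)
    have "L (0 *\<^sub>C 0) = 0 *\<^sub>C L 0"
      using lin complex_vector.subspace_0[OF sub] unfolding clinear_on_def by blast
    moreover have "right_gauge z (0 :: 'n rep_fun2) = 0" "gauge_aut z (0 :: 'n rep_fun) = 0"
      using right_gauge_hom(2)[of z 0 0] gauge_aut_hom(2)[of z 0 0] by simp_all
    ultimately show "0 \<in> G"
      by (simp add: G_def P_def complex_vector.span_zero)
    show "x + y \<in> G" if "x \<in> G" "y \<in> G" for x y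
    proof -
      have "x \<in> A_u_tensor" "y \<in> A_u_tensor" "right_gauge z x \<in> A_u_tensor" "right_gauge z y \<in> A_u_tensor"
        using that P_T by (auto simp: G_def)
      then show ?thesis
        using that lin by (simp add: G_def P_def right_gauge_hom gauge_aut_hom clinear_on_def complex_vector.span_add)
    qed
    show "c *\<^sub>C x \<in> G" if "x \<in> G" for c x
    proof -
      have "x \<in> A_u_tensor" "right_gauge z x \<in> A_u_tensor"
        using that P_T by (auto simp: G_def)
      then show ?thesis
        using that lin by (simp add: G_def P_def right_gauge_hom gauge_aut_hom clinear_on_def complex_vector.span_scale)
    qed
  qed
  moreover have "a \<otimes>\<^sub>f b \<in> G" if "a \<in> A_u" "b \<in> A_u" for a b
    using that gauge_aut_A_u[OF z that(2)]
    by (auto simp: G_def P_def right_gauge_tensor tens gauge_aut_hom intro!: complex_vector.span_base)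
  ultimately have PG: "P \<subseteq> G"
    unfolding P_def by (intro complex_vector.span_minimal) auto
  from x obtain u where u: "\<And>n. u n \<in> P" "u \<longlonglongrightarrow> x"
    by (auto simp: T closure_sequential)
  have gu: "(\<lambda>n. right_gauge z (u n)) \<longlonglongrightarrow> right_gauge z x"
    unfolding right_gauge_def
    by (rule bounded_linear.tendsto[OF bounded_linear_pullback[OF continuous_on_biunitary_prod] u(2)])
  have guP: "right_gauge z (u n) \<in> P" "L (right_gauge z (u n)) = gauge_aut z (L (u n))" for n
    using PG u(1)[of n] by (auto simp: G_def)
  have gx: "right_gauge z x \<in> A_u_tensor"
    unfolding T closure_sequential using guP(1) gu by (intro exI[of _ "\<lambda>n. right_gauge z (u n)"]) simp
  have "(\<lambda>n. L (right_gauge z (u n))) \<longlonglongrightarrow> L (right_gauge z x)"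
    using guP(1) P_T by (intro L_lim gu gx) blast
  moreover have "(\<lambda>n. gauge_aut z (L (u n))) \<longlonglongrightarrow> gauge_aut z (L x)"
    unfolding gauge_aut_def using u P_T
    by (intro bounded_linear.tendsto[OF bounded_linear_pullback[OF continuous_on_biunitary]] L_lim x) auto
  ultimately show ?thesis
    unfolding guP(2) by (rule LIMSEQ_unique)
qed

text \<open>Slicing the coproduct of the rotated element gives \<open>h (gauge_aut z a)\<close>
  times the unit. By the two preceding compatibilities it also gives the rotation of
  \<open>h a\<close> times the unit, and rotations fix the unit.\<close>

lemma haar_state_gauge:
  fixes a :: "'n::finite rep_fun"
  assumes \<Delta>: "coproduct \<Delta>" and h: "haar_state \<Delta> h" and z: "cmod z = 1" and a: "a \<in> polynomials"
  shows "h (gauge_aut z a) = h a"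
proof -
  obtain L where L: "left_slice h L" and inv: "\<And>a. a \<in> A_u \<Longrightarrow> L (\<Delta> a) = h a *\<^sub>C 1"
    using h unfolding haar_state_def by blast
  have aA: "a \<in> A_u" using a polynomials_subset_A_u by blast
  then have "\<Delta> a \<in> A_u_tensor" using \<Delta> unfolding coproduct_def by blast
  have "h (gauge_aut z a) *\<^sub>C 1 = L (\<Delta> (gauge_aut z a))"
    by (simp add: inv gauge_aut_A_u[OF z aA])
  also have "\<dots> = gauge_aut z (L (\<Delta> a))"
    unfolding coproduct_gauge[OF \<Delta> z a] by (rule left_slice_right_gauge[OF L z]) fact
  also have "\<dots> = h a *\<^sub>C 1"
    by (simp add: inv aA gauge_aut_hom)
  finally have "(h (gauge_aut z a) - h a) *\<^sub>C (1 :: 'n rep_fun) = 0"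
    by (simp add: complex_vector.scale_left_diff_distrib)
  then show ?thesis by simp
qed

section \<open>Words in the generators and their gauge degrees\<close>

theorem theorem6p5:
  fixes \<Delta> :: "'n::finite rep_fun \<Rightarrow> 'n rep_fun2"
    and h :: "'n rep_fun \<Rightarrow> complex"
    and \<pi> :: "'n rep_fun \<Rightarrow> 'h::{chilbert_space, perfect_space} bop"
    and \<xi> :: 'h
  assumes "coproduct \<Delta>"
    and "haar_state \<Delta> h"
    and "gns_representation A_u h \<pi> \<xi>"
  shows "metric_approximation_property (nonselfadjoint_algebra \<pi>)"
proof -
  \<comment> \<open>Indexing the generators by pairs makes words lists over a finite alphabet; the
    grading is their length.\<close>
  define g :: "'n \<times> 'n \<Rightarrow> 'n rep_fun" where "g = (\<lambda>(r, s). generator r s)"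
  define word where "word w = prod_list (map g w)" for w
  have state: "state_on (closure polynomials) h"
    using assms(2) by (simp add: haar_state_def closure_polynomials)
  have "star_hom_on A_u \<pi>"
    using assms(3) by (simp add: gns_representation_def)
  note \<pi> = star_hom_onD[OF this]
  have P_A: "a \<in> A_u" if "a \<in> polynomials" for a :: "'n rep_fun"
    using that polynomials_subset_A_u by blast
  note P = star_subalgebraD[OF star_subalgebra_polynomials]
  have word: "word w \<in> polynomials \<and> \<pi> (word w) = prod_list (map (\<lambda>i. \<pi> (g i)) w) \<and>
      (\<forall>z. cmod z = 1 \<longrightarrow> gauge_aut z (word w) = z ^ length w *\<^sub>C word w)" for w
  proof (induction w)
    case Nil
    then show ?case by (simp add: word_def P \<pi> gauge_aut_hom)
  next
    case (Cons i w)
    have gi: "g i \<in> polynomials" "\<And>z. cmod z = 1 \<Longrightarrow> gauge_aut z (g i) = z *\<^sub>C g i"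
      by (auto simp: g_def generator_polynomials gauge_aut_generator split: prod.split)
    have "word (i # w) = g i * word w" by (simp add: word_def)
    then show ?case
      using Cons gi
      by (auto simp: P P_A \<pi> gauge_aut_hom mult_scaleC_left mult_scaleC_right mult_ac)
  qed
  have comb: "(\<Sum>w\<in>T. c w *\<^sub>C word w) \<in> polynomials \<and>
      \<pi> (\<Sum>w\<in>T. c w *\<^sub>C word w) = (\<Sum>w\<in>T. c w *\<^sub>C \<pi> (word w)) \<and>
      (\<forall>z. cmod z = 1 \<longrightarrow>
        gauge_aut z (\<Sum>w\<in>T. c w *\<^sub>C word w) = (\<Sum>w\<in>T. (z ^ length w * c w) *\<^sub>C word w))"
    if "finite T" for T c
    using that
  proof (induction T)
    case empty
    \<comment> \<open>The facts about 0 come from homogeneity with the scalar 0.\<close>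
    have "(0 :: 'n rep_fun) \<in> polynomials" "\<pi> 0 = 0" "gauge_aut z (0 :: 'n rep_fun) = 0" for z
      using P(5)[OF P(2), of 0] \<pi>(5)[OF P_A[OF P(2)], of 0] gauge_aut_hom(2)[of z 0 0] by simp_all
    then show ?case by simp
  next
    case (insert w T)
    then show ?case
      using word[of w] by (auto simp: P P_A \<pi> gauge_aut_hom mult.commute)
  qed
  \<comment> \<open>This is the assumption \<open>gauge\<close> of
    \<open>metric_approximation_property_graded\<close>: on finite sums of words, inserting the
    powers of \<open>z\<close> amounts to applying the gauge automorphism before
    \<open>\<pi>\<close>.\<close>
  have "norm (\<Sum>w\<in>T. z ^ length w *\<^sub>C c w *\<^sub>C \<pi> (word w)) \<le> norm (\<Sum>w\<in>T. c w *\<^sub>C \<pi> (word w))"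
    if "finite T" "cmod z = 1" for T c z
  proof -
    have "norm (\<pi> (gauge_aut z a)) \<le> norm (\<pi> a)" if a: "a \<in> polynomials" for a
      by (rule gns_automorphism_contractive[where M = polynomials and h = h and \<xi> = \<xi>
            and \<beta> = "gauge_aut (cnj z)"])
        (use \<open>cmod z = 1\<close> assms state a in \<open>simp_all add: star_subalgebra_polynomials closure_polynomials
          gauge_aut_polynomials gauge_aut_cnj gauge_aut_hom haar_state_gauge\<close>)
    then have "norm (\<pi> (gauge_aut z (\<Sum>w\<in>T. c w *\<^sub>C word w))) \<le> norm (\<pi> (\<Sum>w\<in>T. c w *\<^sub>C word w))"
      using comb[OF that(1)] by blast
    moreover have "gauge_aut z (\<Sum>w\<in>T. c w *\<^sub>C word w) = (\<Sum>w\<in>T. (z ^ length w * c w) *\<^sub>C word w)"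
      using comb[OF that(1)] that(2) by blast
    moreover have "\<pi> (\<Sum>w\<in>T. b w *\<^sub>C word w) = (\<Sum>w\<in>T. b w *\<^sub>C \<pi> (word w))" for b
      using comb[OF that(1)] by blast
    ultimately show ?thesis by (simp add: scaleC_scaleC)
  qed
  moreover have "finite {w :: ('n \<times> 'n) list. length w < N}" for N
    using finite_lists_length_le[of "UNIV :: ('n \<times> 'n) set" N] by (rule finite_subset[rotated]) auto
  ultimately have "metric_approximation_property (closure (complex_vector.span (range (\<lambda>w. \<pi> (word w)))))"
    by (intro metric_approximation_property_graded[where d = length]) auto
  moreover have "{\<pi> (generator r s) | r s. True} = range (\<lambda>i. \<pi> (g i))"
  proof
    show "{\<pi> (generator r s) | r s. True} \<subseteq> range (\<lambda>i. \<pi> (g i))"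
    proof clarify
      fix r s
      have "\<pi> (generator r s) = \<pi> (g (r, s))" by (simp add: g_def)
      then show "\<pi> (generator r s) \<in> range (\<lambda>i. \<pi> (g i))" by (rule range_eqI)
    qed
  qed (auto simp: g_def)
  ultimately show ?thesis
    by (simp add: nonselfadjoint_algebra_def unital_subalgebra_hull_range word)
qed

end
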